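(* Let $\mathbf p=(p_k)_{k\ge0}$ be a probability mass function on $\{0,1,2,\dots\}$ and $Z\sim\mathbf p$. Assume $\mathbb E[Z]<\infty$, $p_0\in(0,1)$, $p_0+p_1<1$ and $\gcd\{j:p_j>0\}=1$. Let $\deg(v_0,n)$ denote the degree of the root $v_0$ in $\mathcal T_n(\mathbf p)$, and let $R,q_*$ be as in the context. (a) If $\mathbb E[Z]>1$, then $$\frac{\deg(v_0,n)}{n}\xrightarrow{P}1-q_*>0\qquad(n\to\infty).$$ (b) If $\mathbb E[Z]\le1$, then for any $\delta>0$, as $n\to\infty$, $$\frac{\deg(v_0,n)}{n^{\frac1R-\delta}}\xrightarrow{a.s.}\infty\qquad\text{and}\qquad\frac{\deg(v_0,n)}{n^{\frac1R}(\log n)^{1+\delta}}\xrightarrow{a.s.}0.$$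
   Context: Discrete model. Let $Z_1,Z_2,\dots$ be i.i.d. with law $\mathbf p$. The random trees $\mathcal T_n=\mathcal T_n(\mathbf p)$, $n\ge1$, are rooted at $v_0$, with edges directed from children to parents. $\mathcal T_1$ has vertices $v_0,v_1$ and a directed edge from $v_1$ to $v_0$. Given $\mathcal T_n$ with vertex set $\{v_0,\dots,v_n\}$, a new vertex $v_{n+1}$ selects a vertex $V_n$ uniformly at random from $\{v_0,\dots,v_n\}$ and attaches (by a directed edge from $v_{n+1}$) to the vertex at distance $\min(Z_{n+1},\mathrm{dist}(v_0,V_n))$ from $V_n$ on the path from $V_n$ to $v_0$. Here $V_n$ and $Z_{n+1}$ are independent of each other and $Z_{n+1}$ is independent of the past. Constants. $f(s)=\sum_{k\ge0}p_ks^k$, $s\ge0$. $s_0$ is the unique positive root of $sf'(s)=f(s)$ if it exists, and otherwise the radius of convergence of $f$. $R:=\lim_{s\uparrow s_0}s/f(s)$. $q_*$ is the smallest positive solution of $f(q)=q$ (the extinction probability of a Galton–Watson process with offspring law $\mathbf p$). *)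

theory Defs
  imports "HOL-Probability.Probability"
begin

section \<open>The random recursive tree with backward steps\<close>

text \<open>
  A tree with vertices \<open>v_0, \<dots>, v_n\<close> rooted at \<open>v_0\<close> is encoded by its parent map
  \<open>par\<close> on the indices: for \<open>1 \<le> i \<le> n\<close> there is a directed edge from \<open>v_i\<close> to
  \<open>v_(par i)\<close>. The values of \<open>par\<close> at \<open>0\<close> and beyond \<open>n\<close> are irrelevant (they are \<open>0\<close> below).
\<close>

definition root_dist :: "(nat \<Rightarrow> nat) \<Rightarrow> nat \<Rightarrow> nat" where
  "root_dist par v = (LEAST k. (par ^^ k) v = 0)"

definition tree_edges :: "nat \<Rightarrow> (nat \<Rightarrow> nat) \<Rightarrow> (nat \<times> nat) set" where
  "tree_edges n par = {(i, par i) | i. 1 \<le> i \<and> i \<le> n}"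

definition tree_degree :: "nat \<Rightarrow> (nat \<Rightarrow> nat) \<Rightarrow> nat \<Rightarrow> nat" where
  "tree_degree n par v = card {e \<in> tree_edges n par. fst e = v \<or> snd e = v}"

definition attach_vertex :: "(nat \<Rightarrow> nat) \<Rightarrow> nat \<Rightarrow> nat \<Rightarrow> nat" where
  "attach_vertex par v z = (par ^^ min z (root_dist par v)) v"

text \<open>
  \<open>tree_at v z n\<close> is the parent map of the tree on \<open>v_0, \<dots>, v_n\<close> built from the selected
  vertices \<open>v\<close> and the step sizes \<open>z\<close>. The process starts at \<open>n = 1\<close>; the value at \<open>0\<close> is a
  dummy, and \<open>v 0\<close>, \<open>z 0\<close>, \<open>z 1\<close> are never used.
\<close>

fun tree_at :: "(nat \<Rightarrow> nat) \<Rightarrow> (nat \<Rightarrow> nat) \<Rightarrow> nat \<Rightarrow> nat \<Rightarrow> nat" where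
  "tree_at v z 0 = (\<lambda>_. 0)"
| "tree_at v z (Suc 0) = (\<lambda>_. 0)"
| "tree_at v z (Suc (Suc n)) =
     (tree_at v z (Suc n))
       (Suc (Suc n) := attach_vertex (tree_at v z (Suc n)) (v (Suc n)) (z (Suc (Suc n))))"

locale backward_step_model = prob_space M
  for M :: "'w measure" and p :: "nat pmf" and V Z :: "nat \<Rightarrow> 'w \<Rightarrow> nat" +
  assumes indep: "indep_vars (\<lambda>_. count_space UNIV) (case_sum V Z) ({1..} <+> {1..})"
    and distr_Z: "\<And>n. 1 \<le> n \<Longrightarrow> distr M (count_space UNIV) (Z n) = measure_pmf p"
    and distr_V: "\<And>n. 1 \<le> n \<Longrightarrow> distr M (count_space UNIV) (V n) = measure_pmf (pmf_of_set {0..n})"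

definition root_degree :: "(nat \<Rightarrow> 'w \<Rightarrow> nat) \<Rightarrow> (nat \<Rightarrow> 'w \<Rightarrow> nat) \<Rightarrow> nat \<Rightarrow> 'w \<Rightarrow> nat" where
  "root_degree V Z n \<omega> = tree_degree n (tree_at (\<lambda>i. V i \<omega>) (\<lambda>i. Z i \<omega>) n) 0"

definition tendsto_in_prob :: "'w measure \<Rightarrow> (nat \<Rightarrow> 'w \<Rightarrow> real) \<Rightarrow> real \<Rightarrow> bool" where
  "tendsto_in_prob M X c \<longleftrightarrow>
     (\<forall>\<epsilon>>0. (\<lambda>n. measure M {\<omega> \<in> space M. \<bar>X n \<omega> - c\<bar> > \<epsilon>}) \<longlonglongrightarrow> 0)"


section \<open>Constants of the step distribution\<close>

definition pgf :: "nat pmf \<Rightarrow> real \<Rightarrow> real" where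
  "pgf p s = (\<Sum>k. pmf p k * s ^ k)"

definition pgf_radius :: "nat pmf \<Rightarrow> ereal" where
  "pgf_radius p = conv_radius (pmf p)"

text \<open>
  Roots are sought below the radius of convergence, where \<open>pgf\<close> is differentiable. A root at
  the radius itself (with one-sided derivative) would give the same value of \<open>s_zero\<close>.
\<close>

definition is_s_root :: "nat pmf \<Rightarrow> real \<Rightarrow> bool" where
  "is_s_root p s \<longleftrightarrow> 0 < s \<and> ereal s < pgf_radius p \<and> s * deriv (pgf p) s = pgf p s"

definition s_zero :: "nat pmf \<Rightarrow> ereal" where
  "s_zero p = (if \<exists>!s. is_s_root p s then ereal (THE s. is_s_root p s) else pgf_radius p)"

text \<open>The limit is over extended reals since \<open>s_zero p\<close> is a priori possibly infinite.\<close>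

definition R_const :: "nat pmf \<Rightarrow> real" where
  "R_const p = Lim (at_left (s_zero p)) (\<lambda>s. real_of_ereal s / pgf p (real_of_ereal s))"

definition q_star :: "nat pmf \<Rightarrow> real" where
  "q_star p = (LEAST q. 0 < q \<and> pgf p q = q)"

end

theory Submission
  imports Defs
begin

text \<open>
  Only the depths of the vertices matter. If \<open>v_{n+1}\<close> is attached after selecting a vertex of
  depth \<open>k\<close> and drawing a step \<open>z\<close>, its depth is \<open>max (k - z) 0 + 1\<close>, and the root degree is the
  number of vertices of depth \<open>1\<close>. The list of depths is therefore a Markov chain driven by the
  linear operator \<open>child_mean\<close>, which sends \<open>h\<close> to \<open>k \<mapsto> E h (max (k - Z) 0 + 1)\<close>, and the sums
  \<open>S_n(h)\<close> of \<open>h\<close> over all depths satisfy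
  \<open>E (S_{n+1}(h) - S_n(h) | past) = S_n(child_mean h) / (n + 1)\<close>. A function with
  \<open>child_mean h = \<lambda> h\<close> thus makes \<open>S_n(h)\<close> grow like \<open>n\<close> to the power \<open>\<lambda>\<close>.

  Supercritical case. Depth performs a random walk with steps \<open>1 - Z\<close> of negative drift, reflected
  at \<open>1\<close>, whose invariant law is geometric with ratio \<open>q_*\<close>; hence the limit \<open>1 - q_*\<close>. For
  \<open>q_* < u < 1\<close>, \<open>child_mean\<close> contracts the weighted Lipschitz seminorm
  \<open>sup_k |h(k+1) - h(k)| u^k\<close> by the factor \<open>\<lambda> = f(u)/u < 1\<close> (\<open>child_mean_contracts_slope\<close>). In the
  recursion for the second moment of \<open>S_n\<close> of a centred function this factor multiplies the drift,
  so the variance is \<open>O(n^(1 + \<lambda>)) = o(n^2)\<close> (\<open>second_moment_bound\<close>), and Chebyshev's inequality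
  concludes.

  Remaining case. Here \<open>\<rho> = 1/R\<close> is the minimum of \<open>f(s)/s\<close>, attained at some \<open>s_0 \<ge> 1\<close>
  (\<open>R_const_optimal\<close>). Because \<open>s_0 \<ge> 1\<close>, the function \<open>k \<mapsto> s_0^(-k)\<close> satisfies
  \<open>child_mean h \<le> \<rho> h\<close>, which bounds the expected root degree by \<open>O(n^\<rho>)\<close>; summing over the times
  \<open>2^m\<close> gives the almost sure upper bound (\<open>root_count_AE_upper\<close>).

  For the lower bound take \<open>\<lambda> < \<rho>\<close>. The solution of the same eigenvalue equation for the walk
  killed at \<open>0\<close> must become nonpositive somewhere, since otherwise the upper limit \<open>X\<close> of its successive
  ratios would satisfy \<open>f(1/X) X \<le> \<lambda>\<close> (\<open>killed_harmonic_not_positive\<close>). Cutting it off there leaves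
  a finitely supported \<open>h \<ge> 0\<close> with \<open>child_mean h \<ge> \<lambda> h\<close>. Then \<open>1 / S_n(h)\<close> is a supermartingale
  decaying at a rate close to \<open>\<lambda>\<close> once \<open>S_n(h)\<close> is large. A chain of corrections
  (\<open>decays_transfer\<close>) turns it into a decaying functional above \<open>1 / deg(v_0, n)\<close>, and the same
  dyadic argument finishes the proof (\<open>root_count_AE_lower\<close>).
\<close>

section \<open>Depths in the tree\<close>

text \<open>
  The selected index is clipped to the list so that the entries of the list of length \<open>n + 1\<close>
  never exceed \<open>n\<close>, whatever the selections. Almost surely the clipping changes nothing.
\<close>

definition depth_step :: "nat list \<Rightarrow> nat \<Rightarrow> nat \<Rightarrow> nat list" where
  "depth_step xs v z = xs @ [Suc (xs ! min v (length xs - 1) - z)]"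

text \<open>
  From the one-vertex list \<open>[0]\<close>, every step yields \<open>[0, 1]\<close>: starting one step before the first tree
  removes the special case of the first edge.
\<close>

primrec depths :: "(nat \<Rightarrow> nat) \<Rightarrow> (nat \<Rightarrow> nat) \<Rightarrow> nat \<Rightarrow> nat list" where
  "depths v z 0 = [0]"
| "depths v z (Suc n) = depth_step (depths v z n) (v n) (z (Suc n))"

lemma length_depths [simp]: "length (depths v z n) = Suc n"
  by (induction n) (auto simp: depth_step_def)

lemma depths_1: "depths v z (Suc 0) = [0, 1]"
  by (simp add: depth_step_def)

lemma take_depths: "k \<le> n \<Longrightarrow> take (Suc k) (depths v z n) = depths v z k"
  by (induction n) (auto simp: depth_step_def le_Suc_eq)

lemma depths_nth_le: "i \<le> n \<Longrightarrow> depths v z n ! i \<le> i"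
proof (induction n arbitrary: i)
  case (Suc n)
  show ?case
  proof (cases "i = Suc n")
    case True
    have "depths v z n ! min (v n) n \<le> n"
      using Suc.IH[of "min (v n) n"] by simp
    then show ?thesis using True by (simp add: depth_step_def nth_append)
  next
    case False
    then show ?thesis using Suc by (simp add: depth_step_def nth_append)
  qed
qed simp

lemma set_depths_subset: "set (depths v z n) \<subseteq> {0..n}"
proof
  fix x assume "x \<in> set (depths v z n)"
  then obtain i where "i \<le> n" "x = depths v z n ! i" by (auto simp: in_set_conv_nth less_Suc_eq_le)
  then show "x \<in> {0..n}" using depths_nth_le[of i n v z] by simp
qed

lemma depths_cong:
  assumes "\<And>i. 1 \<le> i \<Longrightarrow> i < n \<Longrightarrow> v i = v' i" "\<And>i. 2 \<le> i \<Longrightarrow> i \<le> n \<Longrightarrow> z i = z' i"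
  shows "depths v z n = depths v' z' n"
  using assms
proof (induction n)
  case (Suc n)
  then have IH: "depths v z n = depths v' z' n" by simp
  show ?case
  proof (cases n)
    case 0
    then show ?thesis by (simp add: depth_step_def)
  next
    case (Suc m)
    then show ?thesis using IH Suc.prems by simp
  qed
qed simp

text \<open>
  Parents have smaller indices, so ancestors stay among \<open>v_0, \<dots>, v_n\<close> and reach the root.
\<close>

lemma funpow_decreasing:
  assumes "par 0 = 0" "\<And>i. 1 \<le> i \<Longrightarrow> i \<le> n \<Longrightarrow> par i < i" "i \<le> n"
  shows "(par ^^ k) i \<le> i - k"
proof (induction k)
  case (Suc k)
  let ?x = "(par ^^ k) i"
  show ?case
  proof (cases "?x = 0")
    case True then show ?thesis using assms(1) by simp
  next
    case False
    then have "par ?x < ?x" using assms(2)[of ?x] Suc assms(3) by linarith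
    then show ?thesis using Suc by simp
  qed
qed simp

lemma root_dist_0: "root_dist par 0 = 0"
  by (simp add: root_dist_def Least_eq_0)

lemma root_dist_rec:
  assumes "par 0 = 0" "\<And>i. 1 \<le> i \<Longrightarrow> i \<le> n \<Longrightarrow> par i < i" "1 \<le> i" "i \<le> n"
  shows "root_dist par i = Suc (root_dist par (par i))"
proof -
  have "(par ^^ i) i = 0" using funpow_decreasing[of par n i i] assms by simp
  moreover have "(par ^^ 0) i \<noteq> 0" using assms by simp
  ultimately have "root_dist par i = Suc (LEAST m. (par ^^ Suc m) i = 0)"
    unfolding root_dist_def by (rule Least_Suc)
  then show ?thesis by (simp add: root_dist_def funpow_swap1)
qed

lemma root_dist_funpow:
  assumes "par 0 = 0" "\<And>i. 1 \<le> i \<Longrightarrow> i \<le> n \<Longrightarrow> par i < i" "i \<le> n"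
  shows "root_dist par ((par ^^ k) i) = root_dist par i - k"
proof (induction k)
  case (Suc k)
  let ?x = "(par ^^ k) i"
  have x: "?x \<le> n" using funpow_decreasing[of par n i k] assms by simp
  show ?case
  proof (cases "?x = 0")
    case True then show ?thesis using Suc assms(1) by (simp add: root_dist_0)
  next
    case False
    then show ?thesis using root_dist_rec[of par n ?x] x assms Suc by simp
  qed
qed simp

text \<open>
  Attaching a new vertex does not move the old ones.
\<close>

lemma root_dist_cong:
  assumes "par 0 = 0" "\<And>i. 1 \<le> i \<Longrightarrow> i \<le> n \<Longrightarrow> par i < i" "\<And>i. i \<le> n \<Longrightarrow> par' i = par i"
    and "i \<le> n"
  shows "root_dist par' i = root_dist par i"
proof -
  have "(par' ^^ k) i = (par ^^ k) i" for k
  proof (induction k)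
    case (Suc k)
    have "(par ^^ k) i \<le> n" using funpow_decreasing[of par n i k] assms by simp
    then show ?case using Suc assms(3) by simp
  qed simp
  then show ?thesis by (simp add: root_dist_def)
qed

text \<open>
  Walking \<open>min z d\<close> steps up from depth \<open>d\<close> ends at depth \<open>d - z\<close> (truncated), and the new vertex
  lies one level below; truncated subtraction on \<open>nat\<close> is exactly the reflection at the root.
\<close>

lemma tree_at_depths:
  assumes "1 \<le> n" "\<And>i. 1 \<le> i \<Longrightarrow> v i \<le> i"
  shows "tree_at v z n 0 = 0 \<and> (\<forall>i. 1 \<le> i \<and> i \<le> n \<longrightarrow> tree_at v z n i < i)
    \<and> (\<forall>i\<le>n. root_dist (tree_at v z n) i = depths v z n ! i)"
  using assms(1)
proof (induction n rule: nat_induct_at_least)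
  case base
  have "root_dist (\<lambda>_. 0) 1 = 1"
    using root_dist_rec[of "\<lambda>_. 0" 1 1] root_dist_0 by simp
  then show ?case by (auto simp: root_dist_0 depth_step_def le_Suc_eq)
next
  case (Suc n)
  obtain m where m: "n = Suc m" using Suc.hyps by (cases n) auto
  define par where "par = tree_at v z n"
  define a where "a = attach_vertex par (v n) (z (Suc n))"
  have par: "par 0 = 0" "\<And>i. 1 \<le> i \<Longrightarrow> i \<le> n \<Longrightarrow> par i < i"
    and rd: "\<And>i. i \<le> n \<Longrightarrow> root_dist par i = depths v z n ! i"
    using Suc.IH by (auto simp: par_def)
  have vn: "v n \<le> n" using assms(2) Suc.hyps by simp
  have par': "tree_at v z (Suc n) = par(Suc n := a)"
    by (simp add: m par_def a_def)
  have an: "a \<le> n"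
    using funpow_decreasing[of par n "v n" "min (z (Suc n)) (root_dist par (v n))"] par vn
    by (simp add: a_def attach_vertex_def)
  have ra: "root_dist par a = depths v z n ! v n - z (Suc n)"
    using root_dist_funpow[of par n "v n"] par vn rd[of "v n"] by (simp add: a_def attach_vertex_def)
  have par'_lt: "(par(Suc n := a)) i < i" if "1 \<le> i" "i \<le> Suc n" for i
    using that par an by auto
  have old: "root_dist (par(Suc n := a)) i = root_dist par i" if "i \<le> n" for i
    using root_dist_cong[of par n "par(Suc n := a)" i] par that by auto
  have new: "root_dist (par(Suc n := a)) (Suc n) = Suc (root_dist par a)"
    using root_dist_rec[of "par(Suc n := a)" "Suc n" "Suc n"] par par'_lt old[OF an] by simp
  have nth: "depths v z (Suc n) ! i = (if i \<le> n then depths v z n ! i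
      else Suc (depths v z n ! v n - z (Suc n)))" if "i \<le> Suc n" for i
    using that vn by (auto simp: depth_step_def nth_append le_Suc_eq min_def)
  show ?case
    unfolding par'
  proof (intro conjI allI impI)
    show "(par(Suc n := a)) 0 = 0" using par by simp
    show "(par(Suc n := a)) i < i" if "1 \<le> i \<and> i \<le> Suc n" for i
      using par'_lt that by blast
    show "root_dist (par(Suc n := a)) i = depths v z (Suc n) ! i" if "i \<le> Suc n" for i
    proof (cases "i \<le> n")
      case True
      then show ?thesis unfolding nth[OF that] using old rd by simp
    next
      case False
      then have "i = Suc n" using that by simp
      then show ?thesis unfolding nth[OF that] using new ra by simp
    qed
  qed
qed

text \<open>
  The root has no outgoing edge, so its degree counts its children, which are the vertices of depth \<open>1\<close>.
\<close>

lemma tree_degree_root: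
  assumes "1 \<le> n" "\<And>i. 1 \<le> i \<Longrightarrow> v i \<le> i"
  shows "tree_degree n (tree_at v z n) 0 = count_list (depths v z n) 1"
proof -
  define par where "par = tree_at v z n"
  have par: "par 0 = 0" "\<And>i. 1 \<le> i \<Longrightarrow> i \<le> n \<Longrightarrow> par i < i"
    and rd: "\<And>i. i \<le> n \<Longrightarrow> root_dist par i = depths v z n ! i"
    using tree_at_depths[OF assms, where z = z] by (auto simp: par_def)
  have depth1: "depths v z n ! i = 1 \<longleftrightarrow> par i = 0" if "1 \<le> i" "i \<le> n" for i
  proof -
    have lt: "par i < i" using par(2) that by blast
    have "root_dist par (par i) = 0 \<longleftrightarrow> par i = 0"
      using root_dist_rec[of par n "par i"] par lt that
      by (cases "par i = 0") (auto simp: root_dist_0)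
    then show ?thesis using rd[OF that(2)] root_dist_rec[of par n i] par that by auto
  qed
  have d0: "depths v z n ! 0 = 0" using depths_nth_le[of 0 n v z] by simp
  have "{e \<in> tree_edges n par. fst e = 0 \<or> snd e = 0}
      = (\<lambda>i. (i, par i)) ` {i. i < Suc n \<and> depths v z n ! i = 1}"
    unfolding tree_edges_def
  proof (intro equalityI subsetI)
    fix e assume "e \<in> {e \<in> {(i, par i) |i. 1 \<le> i \<and> i \<le> n}. fst e = 0 \<or> snd e = 0}"
    then show "e \<in> (\<lambda>i. (i, par i)) ` {i. i < Suc n \<and> depths v z n ! i = 1}"
      using depth1 by auto
  next
    fix e assume "e \<in> (\<lambda>i. (i, par i)) ` {i. i < Suc n \<and> depths v z n ! i = 1}"
    then obtain i where i: "e = (i, par i)" "i \<le> n" "depths v z n ! i = 1" by auto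
    then have "1 \<le> i" using d0 by (cases i) auto
    then show "e \<in> {e \<in> {(i, par i) |i. 1 \<le> i \<and> i \<le> n}. fst e = 0 \<or> snd e = 0}"
      using i depth1[of i] by auto
  qed
  then have "tree_degree n par 0 = card {i. i < Suc n \<and> depths v z n ! i = 1}"
    unfolding tree_degree_def by (simp add: card_image inj_on_def)
  also have "\<dots> = count_list (depths v z n) 1"
    by (simp add: count_list_eq_length_filter length_filter_conv_card eq_commute)
  finally show ?thesis by (simp add: par_def)
qed

section \<open>Averaging over the next vertex\<close>

definition depth_sum :: "(nat \<Rightarrow> real) \<Rightarrow> nat list \<Rightarrow> real" where
  "depth_sum h xs = (\<Sum>x\<leftarrow>xs. h x)"

lemma depth_sum_append: "depth_sum h (xs @ ys) = depth_sum h xs + depth_sum h ys"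
  by (simp add: depth_sum_def)

lemma depth_sum_singleton [simp]: "depth_sum h [x] = h x"
  by (simp add: depth_sum_def)

lemma depth_sum_mono: "(\<And>k. f k \<le> g k) \<Longrightarrow> depth_sum f xs \<le> depth_sum g xs"
  unfolding depth_sum_def by (intro sum_list_mono) auto

lemma depth_sum_add: "depth_sum (\<lambda>k. f k + g k) xs = depth_sum f xs + depth_sum g xs"
  by (simp add: depth_sum_def sum_list_addf)

lemma depth_sum_cmult: "depth_sum (\<lambda>k. c * f k) xs = c * depth_sum f xs"
  by (simp add: depth_sum_def sum_list_const_mult)

lemma depth_sum_const: "depth_sum (\<lambda>_. c) xs = c * real (length xs)"
  by (simp add: depth_sum_def sum_list_triv)

lemma depth_sum_nonneg: "(\<And>k. 0 \<le> f k) \<Longrightarrow> 0 \<le> depth_sum f xs"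
  unfolding depth_sum_def by (intro sum_list_nonneg) auto

text \<open>
  The mean of \<open>h\<close> at the depth of a new vertex whose selected vertex has depth \<open>k\<close>.
\<close>

definition child_mean :: "nat pmf \<Rightarrow> (nat \<Rightarrow> real) \<Rightarrow> nat \<Rightarrow> real" where
  "child_mean p h k = measure_pmf.expectation p (\<lambda>z. h (Suc (k - z)))"

text \<open>
  The truncated difference takes values in \<open>{0..k}\<close>, so the integrand is bounded.
\<close>

lemma integrable_truncated_diff:
  fixes g :: "nat \<Rightarrow> real"
  shows "integrable (measure_pmf p) (\<lambda>z. g (k - z))"
proof (rule measure_pmf.integrable_const_bound[where B = "\<Sum>i\<le>k. \<bar>g i\<bar>"])
  have "\<bar>g (k - z)\<bar> \<le> (\<Sum>i\<le>k. \<bar>g i\<bar>)" for z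
    by (rule member_le_sum) auto
  then show "AE z in measure_pmf p. norm (g (k - z)) \<le> (\<Sum>i\<le>k. \<bar>g i\<bar>)" by simp
qed simp

lemma child_mean_mono:
  assumes "\<And>d. 1 \<le> d \<Longrightarrow> d \<le> Suc k \<Longrightarrow> f d \<le> g d"
  shows "child_mean p f k \<le> child_mean p g k"
  unfolding child_mean_def
  using assms by (intro integral_mono integrable_truncated_diff[of p "\<lambda>i. _ (Suc i)"]) auto

lemma child_mean_const [simp]: "child_mean p (\<lambda>_. c) k = c"
  by (simp add: child_mean_def)

lemma child_mean_nonneg: "(\<And>d. 0 \<le> f d) \<Longrightarrow> 0 \<le> child_mean p f k"
  by (simp add: child_mean_def)

lemma child_mean_add: "child_mean p (\<lambda>d. f d + g d) k = child_mean p f k + child_mean p g k"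
  unfolding child_mean_def
  by (intro Bochner_Integration.integral_add integrable_truncated_diff[of p "\<lambda>i. _ (Suc i)"])

lemma child_mean_diff: "child_mean p (\<lambda>d. f d - g d) k = child_mean p f k - child_mean p g k"
  unfolding child_mean_def
  by (intro Bochner_Integration.integral_diff integrable_truncated_diff[of p "\<lambda>i. _ (Suc i)"])

lemma child_mean_cmult: "child_mean p (\<lambda>d. c * f d) k = c * child_mean p f k"
  by (simp add: child_mean_def)

text \<open>
  One step of the Markov chain of depth lists, acting on functionals of the list: the selected vertex
  is uniform and the step is drawn from \<open>p\<close>.
\<close>

definition avg_next :: "nat pmf \<Rightarrow> (nat list \<Rightarrow> real) \<Rightarrow> nat list \<Rightarrow> real" where
  "avg_next p \<Phi> xs = (\<Sum>x\<leftarrow>xs. child_mean p (\<lambda>d. \<Phi> (xs @ [d])) x) / real (length xs)"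

lemma avg_next_mono:
  assumes "\<And>d. \<Phi> (xs @ [d]) \<le> \<Psi> (xs @ [d])"
  shows "avg_next p \<Phi> xs \<le> avg_next p \<Psi> xs"
  unfolding avg_next_def using assms by (intro divide_right_mono sum_list_mono child_mean_mono) auto

lemma avg_next_add: "avg_next p (\<lambda>xs. \<Phi> xs + \<Psi> xs) xs = avg_next p \<Phi> xs + avg_next p \<Psi> xs"
  by (simp add: avg_next_def child_mean_add sum_list_addf add_divide_distrib)

lemma avg_next_cmult: "avg_next p (\<lambda>xs. c * \<Phi> xs) xs = c * avg_next p \<Phi> xs"
  by (simp add: avg_next_def child_mean_cmult sum_list_const_mult)

lemma avg_next_cong:
  assumes "\<And>d. \<Phi> (xs @ [d]) = \<Psi> (xs @ [d])"
  shows "avg_next p \<Phi> xs = avg_next p \<Psi> xs"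
  using assms by (simp add: avg_next_def)

lemma avg_next_const: "xs \<noteq> [] \<Longrightarrow> avg_next p (\<lambda>_. c) xs = c"
  by (simp add: avg_next_def sum_list_triv)

lemma avg_next_last: "avg_next p (\<lambda>ys. h (last ys)) xs = depth_sum (child_mean p h) xs / real (length xs)"
  by (simp add: avg_next_def depth_sum_def)

lemma avg_next_depth_sum:
  assumes "xs \<noteq> []"
  shows "avg_next p (depth_sum h) xs = depth_sum h xs + depth_sum (child_mean p h) xs / real (length xs)"
proof -
  have "avg_next p (depth_sum h) xs = avg_next p (\<lambda>ys. depth_sum h xs + h (last ys)) xs"
    by (rule avg_next_cong) (simp add: depth_sum_append)
  then show ?thesis by (simp add: avg_next_add avg_next_const[OF assms] avg_next_last)
qed

text \<open>
  Expand the square of the old sum plus the new term; the three summands are the square of the sum, the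
  cross term, and the noise contributed by the new vertex.
\<close>

lemma avg_next_depth_sum_square:
  assumes "xs \<noteq> []"
  shows "avg_next p (\<lambda>ys. (depth_sum h ys)\<^sup>2) xs = (depth_sum h xs)\<^sup>2
    + 2 * depth_sum h xs * depth_sum (child_mean p h) xs / real (length xs)
    + depth_sum (child_mean p (\<lambda>k. (h k)\<^sup>2)) xs / real (length xs)"
proof -
  have "avg_next p (\<lambda>ys. (depth_sum h ys)\<^sup>2) xs
      = avg_next p (\<lambda>ys. (depth_sum h xs)\<^sup>2 + (2 * depth_sum h xs * h (last ys) + (h (last ys))\<^sup>2)) xs"
    by (rule avg_next_cong) (simp add: depth_sum_append power2_sum)
  also have "\<dots> = (depth_sum h xs)\<^sup>2
    + (2 * depth_sum h xs * (depth_sum (child_mean p h) xs / real (length xs))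
      + depth_sum (child_mean p (\<lambda>k. (h k)\<^sup>2)) xs / real (length xs))"
    by (simp only: avg_next_add avg_next_cmult avg_next_const[OF assms]
        avg_next_last[of p h] avg_next_last[of p "\<lambda>k. (h k)\<^sup>2"])
  finally show ?thesis by simp
qed

section \<open>The Markov chain of depth lists\<close>

definition histories :: "nat \<Rightarrow> nat list set" where
  "histories n = {xs. set xs \<subseteq> {0..n} \<and> length xs = Suc n}"

text \<open>
  Each depth list takes finitely many values, so every functional of it is integrable and the
  expectations below can be split over these values.
\<close>

lemma finite_histories: "finite (histories n)"
  unfolding histories_def by (rule finite_lists_length_eq) simp

context backward_step_model
begin

definition depth_list :: "nat \<Rightarrow> 'w \<Rightarrow> nat list" where
  "depth_list n \<omega> = depths (\<lambda>i. V i \<omega>) (\<lambda>i. Z i \<omega>) n"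

lemma length_depth_list [simp]: "length (depth_list n \<omega>) = Suc n"
  by (simp add: depth_list_def)

lemma depth_list_neq_Nil [simp]: "depth_list n \<omega> \<noteq> []"
  by (metis length_depth_list list.size(3) nat.distinct(1))

lemma depth_list_1: "depth_list (Suc 0) \<omega> = [0, 1]"
  unfolding depth_list_def by (rule depths_1)

lemma take_depth_list: "k \<le> n \<Longrightarrow> take (Suc k) (depth_list n \<omega>) = depth_list k \<omega>"
  unfolding depth_list_def by (rule take_depths)

lemma depth_list_in_histories: "depth_list n \<omega> \<in> histories n"
  using set_depths_subset by (simp add: histories_def depth_list_def)

lemma depth_sum_depth_list_mono:
  assumes "\<And>k. 0 \<le> h k" "m \<le> n"
  shows "depth_sum h (depth_list m \<omega>) \<le> depth_sum h (depth_list n \<omega>)"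
  using assms(2)
proof (induction n rule: dec_induct)
  case (step n)
  have "depth_sum h (depth_list n \<omega>) \<le> depth_sum h (depth_list (Suc n) \<omega>)"
    using assms(1) by (simp add: depth_list_def depth_step_def depth_sum_append)
  then show ?case using step by simp
qed simp

lemma root_count_ge_1: "1 \<le> n \<Longrightarrow> 1 \<le> depth_sum (indicator {1}) (depth_list n \<omega>)"
  using depth_sum_depth_list_mono[of "indicator {1}" "Suc 0" n \<omega>] by (simp add: depth_list_1) (simp add: depth_sum_def)

abbreviation (input) "past n \<equiv> (Inl ` {1..<n} \<union> Inr ` {1..n} :: (nat + nat) set)"

abbreviation (input) "present n \<equiv> ({Inl n, Inr (Suc n)} :: (nat + nat) set)"

text \<open>
  A finite product of countable discrete spaces is discrete, so measurability is automatic.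
\<close>

lemma measurable_finite_family:
  assumes "finite I"
  shows "g \<in> measurable (PiM I (\<lambda>_. count_space (UNIV::nat set))) (count_space UNIV)"
    "f \<in> measurable (PiM I (\<lambda>_. count_space (UNIV::nat set))) borel"
proof -
  have "PiM I (\<lambda>_. count_space (UNIV::nat set)) = count_space (PiE I (\<lambda>_. UNIV))"
    using assms by (intro count_space_PiM_finite) auto
  then show "g \<in> measurable (PiM I (\<lambda>_. count_space (UNIV::nat set))) (count_space UNIV)"
    "f \<in> measurable (PiM I (\<lambda>_. count_space (UNIV::nat set))) borel" by simp_all
qed

lemma measurable_V: "1 \<le> n \<Longrightarrow> V n \<in> measurable M (count_space UNIV)"
  using bspec[OF conjunct1[OF indep[unfolded indep_vars_def]], of "Inl n"] by auto

lemma measurable_Z: "1 \<le> n \<Longrightarrow> Z n \<in> measurable M (count_space UNIV)"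
  using bspec[OF conjunct1[OF indep[unfolded indep_vars_def]], of "Inr n"] by auto

lemma depth_list_eq_function_of_past:
  "depth_list n \<omega> = depths (\<lambda>i. (\<lambda>j\<in>past n. case_sum V Z j \<omega>) (Inl i)) (\<lambda>i. (\<lambda>j\<in>past n. case_sum V Z j \<omega>) (Inr i)) n"
  unfolding depth_list_def by (rule depths_cong) auto

text \<open>
  The depth list at time \<open>n\<close> is built from \<open>V_1, \<dots>, V_{n-1}\<close> and \<open>Z_1, \<dots>, Z_n\<close> only, a
  block of the independent family disjoint from \<open>V_n\<close> and \<open>Z_{n+1}\<close>.
\<close>

lemma indep_history:
  fixes F :: "nat list \<Rightarrow> real" and G :: "nat \<Rightarrow> nat \<Rightarrow> real"
  assumes "1 \<le> n"
  shows "indep_var borel (\<lambda>\<omega>. F (depth_list n \<omega>)) borel (\<lambda>\<omega>. G (V n \<omega>) (Z (Suc n) \<omega>))"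
proof -
  let ?M = "\<lambda>_. count_space (UNIV::nat set)"
  let ?g = "\<lambda>f. F (depths (\<lambda>i. f (Inl i)) (\<lambda>i. f (Inr i)) n)"
  let ?h = "\<lambda>f. G (f (Inl n :: nat + nat)) (f (Inr (Suc n)))"
  have "indep_var (PiM (past n) ?M) (\<lambda>\<omega>. \<lambda>j\<in>past n. case_sum V Z j \<omega>)
      (PiM (present n) ?M) (\<lambda>\<omega>. \<lambda>j\<in>present n. case_sum V Z j \<omega>)"
    using assms by (intro indep_var_restrict[OF indep]) auto
  then have "indep_var borel (?g \<circ> (\<lambda>\<omega>. \<lambda>j\<in>past n. case_sum V Z j \<omega>))
      borel (?h \<circ> (\<lambda>\<omega>. \<lambda>j\<in>present n. case_sum V Z j \<omega>))"
    by (rule indep_var_compose) (intro measurable_finite_family; simp)+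
  also have "?g \<circ> (\<lambda>\<omega>. \<lambda>j\<in>past n. case_sum V Z j \<omega>) = (\<lambda>\<omega>. F (depth_list n \<omega>))"
    using depth_list_eq_function_of_past[of n] by (auto simp: fun_eq_iff)
  also have "?h \<circ> (\<lambda>\<omega>. \<lambda>j\<in>present n. case_sum V Z j \<omega>) = (\<lambda>\<omega>. G (V n \<omega>) (Z (Suc n) \<omega>))"
    by (auto simp: fun_eq_iff)
  finally show ?thesis .
qed

lemma measurable_depth_list:
  "depth_list n \<in> measurable M (count_space UNIV)"
proof -
  let ?g = "\<lambda>f. depths (\<lambda>i. f (Inl i)) (\<lambda>i. f (Inr i)) n"
  have "(\<lambda>\<omega>. \<lambda>j\<in>past n. case_sum V Z j \<omega>) \<in> measurable M (PiM (past n) (\<lambda>_. count_space UNIV))"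
    using measurable_V measurable_Z by (intro measurable_restrict) auto
  from this have "(\<lambda>\<omega>. ?g (\<lambda>j\<in>past n. case_sum V Z j \<omega>)) \<in> measurable M (count_space UNIV)"
    by (rule measurable_compose) (intro measurable_finite_family; simp)
  also have "(\<lambda>\<omega>. ?g (\<lambda>j\<in>past n. case_sum V Z j \<omega>)) = depth_list n"
    by (rule ext) (rule depth_list_eq_function_of_past[symmetric])
  finally show ?thesis .
qed

lemma indep_V_Z:
  fixes F G :: "nat \<Rightarrow> real"
  assumes "1 \<le> n"
  shows "indep_var borel (\<lambda>\<omega>. F (V n \<omega>)) borel (\<lambda>\<omega>. G (Z (Suc n) \<omega>))"
proof -
  let ?M = "\<lambda>_. count_space (UNIV::nat set)"
  have "indep_var (PiM {Inl n} ?M) (\<lambda>\<omega>. \<lambda>j\<in>{Inl n}. case_sum V Z j \<omega>)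
      (PiM {Inr (Suc n)} ?M) (\<lambda>\<omega>. \<lambda>j\<in>{Inr (Suc n)}. case_sum V Z j \<omega>)"
    using assms by (intro indep_var_restrict[OF indep]) auto
  then have "indep_var borel ((\<lambda>f. F (f (Inl n))) \<circ> (\<lambda>\<omega>. \<lambda>j\<in>{Inl n}. case_sum V Z j \<omega>))
      borel ((\<lambda>f. G (f (Inr (Suc n)))) \<circ> (\<lambda>\<omega>. \<lambda>j\<in>{Inr (Suc n)}. case_sum V Z j \<omega>))"
    by (rule indep_var_compose) (intro measurable_finite_family; simp)+
  then show ?thesis by (simp add: comp_def)
qed

lemma integrable_depth_list:
  fixes \<Phi> :: "nat list \<Rightarrow> real"
  shows "integrable M (\<lambda>\<omega>. \<Phi> (depth_list n \<omega>))"
proof (rule integrable_const_bound[where B = "\<Sum>xs\<in>histories n. \<bar>\<Phi> xs\<bar>"])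
  show "AE \<omega> in M. norm (\<Phi> (depth_list n \<omega>)) \<le> (\<Sum>xs\<in>histories n. \<bar>\<Phi> xs\<bar>)"
    using depth_list_in_histories finite_histories
    by (auto intro!: AE_I2 member_le_sum[where f = "\<lambda>xs. \<bar>\<Phi> xs\<bar>"])
  show "(\<lambda>\<omega>. \<Phi> (depth_list n \<omega>)) \<in> borel_measurable M"
    using measurable_compose[OF measurable_depth_list, of \<Phi>] by simp
qed

lemma prob_V:
  assumes "1 \<le> n" "v \<le> n"
  shows "prob (V n -` {v} \<inter> space M) = 1 / real (Suc n)"
proof -
  have "prob (V n -` {v} \<inter> space M) = measure (distr M (count_space UNIV) (V n)) {v}"
    using measurable_V[OF assms(1)] by (simp add: measure_distr)
  also have "\<dots> = 1 / real (Suc n)"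
    using assms by (simp add: distr_V measure_pmf_single)
  finally show ?thesis .
qed

lemma AE_V_le: "AE \<omega> in M. \<forall>i\<ge>1. V i \<omega> \<le> i"
proof -
  have "AE \<omega> in M. i \<ge> 1 \<longrightarrow> V i \<omega> \<le> i" for i
  proof (cases "i \<ge> 1")
    case True
    have "AE x in distr M (count_space UNIV) (V i). x \<le> i"
      unfolding distr_V[OF True] by (simp add: AE_measure_pmf_iff)
    then show ?thesis
      using AE_distrD[OF measurable_V[OF True]] by auto
  qed simp
  then show ?thesis by (simp add: AE_all_countable)
qed

lemma expectation_Z:
  fixes g :: "nat \<Rightarrow> real"
  assumes "1 \<le> n"
  shows "expectation (\<lambda>\<omega>. g (Z n \<omega>)) = measure_pmf.expectation p g"
  using integral_distr[OF measurable_Z[OF assms], of g] distr_Z[OF assms] by simp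

text \<open>
  The Markov property in integrated form. Splitting according to the values of the depth list and of
  \<open>V_n\<close> turns the claim into finitely many product formulas for independent factors.
\<close>

lemma expectation_step:
  assumes "1 \<le> n"
  shows "expectation (\<lambda>\<omega>. \<Phi> (depth_list (Suc n) \<omega>)) = expectation (\<lambda>\<omega>. avg_next p \<Phi> (depth_list n \<omega>))"
proof -
  define g where "g xs v z = \<Phi> (xs @ [Suc (xs ! v - z)])" for xs v z
  define iD where "iD xs \<omega> = (indicator {xs} (depth_list n \<omega>) :: real)" for xs \<omega>
  define iV where "iV v \<omega> = (indicator {v} (V n \<omega>) :: real)" for v \<omega>
  have [measurable]: "depth_list n \<in> measurable M (count_space UNIV)" "V n \<in> measurable M (count_space UNIV)"
    "Z (Suc n) \<in> measurable M (count_space UNIV)"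
    using measurable_depth_list measurable_V measurable_Z assms by auto
  have gZ_int: "integrable M (\<lambda>\<omega>. g xs v (Z (Suc n) \<omega>))" for xs v
  proof -
    have "integrable (distr M (count_space UNIV) (Z (Suc n))) (g xs v)"
      using integrable_truncated_diff[of p "\<lambda>i. \<Phi> (xs @ [Suc i])"]
      by (simp add: distr_Z g_def[abs_def])
    then show ?thesis by (simp add: integrable_distr_eq)
  qed
  have iV_int: "integrable M (iV v)" for v
    unfolding iV_def using measurable_compose[OF measurable_V[OF assms], of "indicator {v}" borel]
    by (intro integrable_const_bound[where B = 1]) auto
  have iD_int: "integrable M (iD xs)" for xs
    unfolding iD_def by (rule integrable_depth_list)
  have E_iV: "expectation (iV v) = 1 / real (Suc n)" if "v \<le> n" for v
  proof -
    have "expectation (iV v) = expectation (indicator (V n -` {v} \<inter> space M))"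
      unfolding iV_def by (intro Bochner_Integration.integral_cong) (auto simp: indicator_def)
    then show ?thesis using prob_V[OF assms that] by simp
  qed
  have ind1: "indep_var borel (iV v) borel (\<lambda>\<omega>. g xs v (Z (Suc n) \<omega>))" for v xs
    using indep_V_Z[OF assms, of "indicator {v}" "g xs v"] by (simp add: iV_def[abs_def])
  have ind2: "indep_var borel (iD xs) borel (\<lambda>\<omega>. iV v \<omega> * g xs v (Z (Suc n) \<omega>))" for v xs
    using indep_history[OF assms, of "indicator {xs}" "\<lambda>v' z. indicator {v} v' * g xs v z"]
    by (simp add: iV_def[abs_def] iD_def[abs_def])
  have iVg_int: "integrable M (\<lambda>\<omega>. iV v \<omega> * g xs v (Z (Suc n) \<omega>))" for v xs
    by (rule indep_var_integrable[OF ind1 iV_int gZ_int])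
  have term_int: "integrable M (\<lambda>\<omega>. iD xs \<omega> * (iV v \<omega> * g xs v (Z (Suc n) \<omega>)))" for xs v
    by (rule indep_var_integrable[OF ind2 iD_int iVg_int])
  have term_val: "expectation (\<lambda>\<omega>. iD xs \<omega> * (iV v \<omega> * g xs v (Z (Suc n) \<omega>)))
      = expectation (iD xs) * (child_mean p (\<lambda>d. \<Phi> (xs @ [d])) (xs ! v) / real (Suc n))" if "v \<le> n" for xs v
    using indep_var_lebesgue_integral[OF ind2[of xs v] iD_int iVg_int]
      indep_var_lebesgue_integral[OF ind1[of v xs] iV_int gZ_int] E_iV[OF that]
      expectation_Z[of "Suc n" "g xs v"]
    by (simp add: child_mean_def g_def[abs_def])
  have "expectation (\<lambda>\<omega>. \<Phi> (depth_list (Suc n) \<omega>))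
      = expectation (\<lambda>\<omega>. \<Sum>xs\<in>histories n. \<Sum>v\<le>n. iD xs \<omega> * (iV v \<omega> * g xs v (Z (Suc n) \<omega>)))"
  proof (rule integral_cong_AE)
    show "(\<lambda>\<omega>. \<Phi> (depth_list (Suc n) \<omega>)) \<in> borel_measurable M"
      using integrable_depth_list[of \<Phi> "Suc n"] by simp
    show "(\<lambda>\<omega>. \<Sum>xs\<in>histories n. \<Sum>v\<le>n. iD xs \<omega> * (iV v \<omega> * g xs v (Z (Suc n) \<omega>))) \<in> borel_measurable M"
      using term_int by (intro borel_measurable_sum) auto
    show "AE \<omega> in M. \<Phi> (depth_list (Suc n) \<omega>)
        = (\<Sum>xs\<in>histories n. \<Sum>v\<le>n. iD xs \<omega> * (iV v \<omega> * g xs v (Z (Suc n) \<omega>)))"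
      using AE_V_le
    proof eventually_elim
      case (elim \<omega>)
      then have V: "V n \<omega> \<le> n" using assms by simp
      have "(\<Sum>xs\<in>histories n. \<Sum>v\<le>n. iD xs \<omega> * (iV v \<omega> * g xs v (Z (Suc n) \<omega>)))
          = (\<Sum>xs\<in>histories n. if depth_list n \<omega> = xs then (\<Sum>v\<le>n. if V n \<omega> = v then g xs v (Z (Suc n) \<omega>) else 0) else 0)"
        by (intro sum.cong refl) (auto simp: iD_def iV_def indicator_def intro!: sum.cong)
      also have "\<dots> = g (depth_list n \<omega>) (V n \<omega>) (Z (Suc n) \<omega>)"
        using depth_list_in_histories finite_histories V by simp
      also have "\<dots> = \<Phi> (depth_list (Suc n) \<omega>)"
        using V by (simp add: g_def depth_list_def depth_step_def min_def)
      finally show ?case by simp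
    qed
  qed
  \<comment> \<open>independence of the past, the selected vertex and the step\<close>
  also have "\<dots> = (\<Sum>xs\<in>histories n. \<Sum>v\<le>n. expectation (iD xs) * (child_mean p (\<lambda>d. \<Phi> (xs @ [d])) (xs ! v) / real (Suc n)))"
    using term_int term_val by (simp add: Bochner_Integration.integral_sum Bochner_Integration.integrable_sum)
  also have "\<dots> = (\<Sum>xs\<in>histories n. expectation (iD xs) * avg_next p \<Phi> xs)"
  proof (rule sum.cong[OF refl])
    fix xs assume "xs \<in> histories n"
    then have len: "length xs = Suc n" by (simp add: histories_def)
    have "{0..<Suc n} = {..n}" by auto
    then have "(\<Sum>x\<leftarrow>xs. child_mean p (\<lambda>d. \<Phi> (xs @ [d])) x) = (\<Sum>v\<le>n. child_mean p (\<lambda>d. \<Phi> (xs @ [d])) (xs ! v))"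
      by (simp add: sum_list_sum_nth len)
    then show "(\<Sum>v\<le>n. expectation (iD xs) * (child_mean p (\<lambda>d. \<Phi> (xs @ [d])) (xs ! v) / real (Suc n)))
        = expectation (iD xs) * avg_next p \<Phi> xs"
      by (simp only: avg_next_def len sum_distrib_left[symmetric] sum_divide_distrib[symmetric])
  qed
  also have "\<dots> = expectation (\<lambda>\<omega>. \<Sum>xs\<in>histories n. iD xs \<omega> * avg_next p \<Phi> xs)"
    using iD_int by (simp add: Bochner_Integration.integral_sum)
  also have "\<dots> = expectation (\<lambda>\<omega>. avg_next p \<Phi> (depth_list n \<omega>))"
  proof (rule Bochner_Integration.integral_cong[OF refl])
    fix \<omega>
    have "(\<Sum>xs\<in>histories n. iD xs \<omega> * avg_next p \<Phi> xs)
        = (\<Sum>xs\<in>histories n. if depth_list n \<omega> = xs then avg_next p \<Phi> xs else 0)"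
      by (intro sum.cong) (auto simp: iD_def)
    then show "(\<Sum>xs\<in>histories n. iD xs \<omega> * avg_next p \<Phi> xs) = avg_next p \<Phi> (depth_list n \<omega>)"
      using depth_list_in_histories finite_histories by simp
  qed
  finally show ?thesis .
qed

lemma expectation_depth_sum_step:
  assumes "1 \<le> n"
  shows "expectation (\<lambda>\<omega>. depth_sum h (depth_list (Suc n) \<omega>))
    = expectation (\<lambda>\<omega>. depth_sum h (depth_list n \<omega>))
      + expectation (\<lambda>\<omega>. depth_sum (child_mean p h) (depth_list n \<omega>)) / real (Suc n)"
  using assms by (simp add: expectation_step avg_next_depth_sum integrable_depth_list)

text \<open>
  Holds outside the null event that some \<open>V_i\<close> exceeds \<open>i\<close>.
\<close>

lemma root_degree_eq:
  "AE \<omega> in M. \<forall>n\<ge>1. real (root_degree V Z n \<omega>) = depth_sum (indicator {1}) (depth_list n \<omega>)"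
  using AE_V_le
proof eventually_elim
  case (elim \<omega>)
  have "real (count_list xs 1) = depth_sum (indicator {1}) xs" for xs
    by (induction xs) (auto simp: depth_sum_def)
  then show ?case using tree_degree_root[where v = "\<lambda>i. V i \<omega>"] elim
    by (auto simp: root_degree_def depth_list_def)
qed

end

section \<open>Comparison with powers of the number of vertices\<close>

text \<open>
  Both this and the next inequality compare \<open>1 + x\<close> with \<open>exp x\<close> and use
  \<open>1/(n+1) \<le> ln((n+1)/n) \<le> 1/n\<close>; they convert multiplicative recursions into powers of \<open>n\<close>.
\<close>

lemma powr_growth_step:
  fixes c :: real
  assumes "0 \<le> c" "1 \<le> n"
  shows "real n powr c * (1 + c / real (Suc n)) \<le> real (Suc n) powr c"
proof -
  have n: "0 < real n" using assms by simp
  have "ln (real n / real (Suc n)) \<le> real n / real (Suc n) - 1"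
    using n by (intro ln_le_minus_one) auto
  also have "\<dots> = - (1 / real (Suc n))" by (simp add: field_simps)
  finally have ln: "1 / real (Suc n) \<le> ln (real (Suc n)) - ln (real n)"
    using n by (simp add: ln_div)
  have "1 + c / real (Suc n) \<le> exp (c / real (Suc n))" by (rule exp_ge_add_one_self)
  also have "\<dots> \<le> exp (c * (ln (real (Suc n)) - ln (real n)))"
    using mult_left_mono[OF ln assms(1)] by simp
  finally have "real n powr c * (1 + c / real (Suc n))
      \<le> real n powr c * exp (c * (ln (real (Suc n)) - ln (real n)))"
    by (rule mult_left_mono) simp
  also have "\<dots> = real (Suc n) powr c"
    using n by (simp add: powr_def algebra_simps flip: exp_add)
  finally show ?thesis .
qed

lemma powr_decay_step:
  fixes c :: real
  assumes "0 \<le> c"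
  shows "1 - c / real (Suc n) \<le> (real (Suc n) / real (Suc (Suc n))) powr c"
proof -
  have "ln (real (Suc (Suc n)) / real (Suc n)) \<le> real (Suc (Suc n)) / real (Suc n) - 1"
    by (intro ln_le_minus_one) auto
  also have "\<dots> = 1 / real (Suc n)" by (simp add: field_simps)
  finally have ln: "ln (real (Suc (Suc n)) / real (Suc n)) \<le> 1 / real (Suc n)" .
  have "1 - c / real (Suc n) \<le> exp (- (c / real (Suc n)))"
    using exp_ge_add_one_self[of "- (c / real (Suc n))"] by simp
  also have "\<dots> \<le> exp (c * ln (real (Suc n) / real (Suc (Suc n))))"
    using mult_left_mono[OF ln assms] by (simp add: ln_div algebra_simps)
  also have "\<dots> = (real (Suc n) / real (Suc (Suc n))) powr c"
    by (simp add: powr_def)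
  finally show ?thesis .
qed

lemma dyadic_bracket:
  assumes "(1::nat) \<le> n" "2 ^ N \<le> n"
  obtains m where "N \<le> m" "2 ^ m \<le> n" "n < 2 ^ Suc m"
proof -
  obtain m where m: "2 ^ m \<le> n" "n < 2 ^ (m + 1)" using ex_power_ivl1[of 2 n] assms(1) by auto
  then have "(2::nat) ^ N < 2 ^ Suc m" using assms(2) by simp
  then have "N < Suc m" by (rule power_less_imp_less_exp[rotated]) simp
  then show ?thesis using m by (intro that[of m]) auto
qed

text \<open>
  A monotone sequence is controlled at all times by its values at the times \<open>2^m\<close>, at the price of
  the constant \<open>2^a\<close>.
\<close>

lemma dyadic_growth:
  fixes L :: "nat \<Rightarrow> real"
  assumes mono: "\<And>m n. 1 \<le> m \<Longrightarrow> m \<le> n \<Longrightarrow> L m \<le> L n" and pos: "\<And>n. 1 \<le> n \<Longrightarrow> 0 < L n"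
    and a: "0 \<le> a" and lim: "(\<lambda>m. (2 ^ m) powr a / L (2 ^ m)) \<longlonglongrightarrow> 0"
  shows "filterlim (\<lambda>n. L n / real n powr a) at_top sequentially"
proof (rule filterlim_at_top_gt[where c = 0, THEN iffD2], intro allI impI)
  fix C :: real assume C: "0 < C"
  have "0 < 1 / (C * 2 powr a)" using C by simp
  from order_tendstoD(2)[OF lim this] obtain N where
    N: "\<And>m. N \<le> m \<Longrightarrow> (2 ^ m) powr a / L (2 ^ m) < 1 / (C * 2 powr a)"
    by (auto simp: eventually_sequentially)
  show "\<forall>\<^sub>F n in sequentially. C \<le> L n / real n powr a"
    using eventually_ge_at_top[of "2 ^ N"]
  proof eventually_elim
    case (elim n)
    have n1: "1 \<le> n" using elim by (meson one_le_numeral one_le_power order_trans)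
    obtain m where m: "N \<le> m" "2 ^ m \<le> n" "n < 2 ^ Suc m" using dyadic_bracket[OF n1 elim] .
    have "real n < real (2 ^ Suc m)" using m(3) by (simp only: of_nat_less_iff)
    then have "real n \<le> 2 * 2 ^ m" by simp
    then have "real n powr a \<le> (2 * 2 ^ m) powr a" using a by (intro powr_mono2) auto
    then have "C * real n powr a \<le> C * 2 powr a * (2 ^ m) powr a"
      using C by (simp add: powr_mult)
    also have "\<dots> \<le> L (2 ^ m)"
      using N[OF m(1)] pos[of "2 ^ m"] C by (simp add: field_simps)
    also have "\<dots> \<le> L n" using mono m by simp
    finally show ?case using n1 by (simp add: pos_le_divide_eq)
  qed
qed

text \<open>
  As for the lower bound, \<open>n\<close> is replaced by the next power of two; \<open>m\<close> and \<open>ln n\<close> are comparable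
  there.
\<close>

lemma dyadic_upper:
  fixes L :: "nat \<Rightarrow> real"
  assumes mono: "\<And>m n. 1 \<le> m \<Longrightarrow> m \<le> n \<Longrightarrow> L m \<le> L n" and nonneg: "\<And>n. 0 \<le> L n"
    and a: "0 \<le> a" and b: "0 \<le> b"
    and lim: "(\<lambda>m. L (2 ^ m) / ((2 ^ m) powr a * real m powr b)) \<longlonglongrightarrow> 0"
  shows "(\<lambda>n. L n / (real n powr a * ln (real n) powr b)) \<longlonglongrightarrow> 0"
proof (rule order_tendstoI)
  fix e :: real assume "e < 0"
  then show "\<forall>\<^sub>F n in sequentially. e < L n / (real n powr a * ln (real n) powr b)"
    using nonneg by (intro always_eventually allI less_le_trans[OF _ divide_nonneg_nonneg]) auto
next
  fix e :: real assume e: "0 < e"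
  \<comment> \<open>passing from \<open>n\<close> to \<open>2^(m+1) \<le> 2 n\<close> costs \<open>2^a\<close>, and \<open>m + 1 \<le> 2 m \<le> 2 ln n / ln 2\<close>\<close>
  define c where "c = 2 powr a * (2 / ln 2) powr b"
  have c: "0 < c" by (simp add: c_def)
  from order_tendstoD(2)[OF lim, of "e / c"] obtain N where
    N: "\<And>m. N \<le> m \<Longrightarrow> L (2 ^ m) / ((2 ^ m) powr a * real m powr b) < e / c"
    using e c by (auto simp: eventually_sequentially)
  show "\<forall>\<^sub>F n in sequentially. L n / (real n powr a * ln (real n) powr b) < e"
    using eventually_ge_at_top[of "2 ^ Suc N"]
  proof eventually_elim
    case (elim n)
    have n1: "1 \<le> n" using elim by (meson one_le_numeral one_le_power order_trans)
    obtain m where m: "Suc N \<le> m" "2 ^ m \<le> n" "n < 2 ^ Suc m" using dyadic_bracket[OF n1 elim] .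
    have m1: "1 \<le> m" using m by simp
    have n2: "2 ^ m \<le> real n" using m(2) by (simp flip: of_nat_le_iff)
    have lnm: "real m * ln 2 \<le> ln (real n)"
      using n2 n1 by (simp flip: ln_realpow)
    have lnpos: "0 < ln (real n)" using lnm m1 by (smt (verit) ln_gt_zero mult_pos_pos of_nat_0_less_iff less_eq_Suc_le One_nat_def)
    have "L n \<le> L (2 ^ Suc m)" using mono[of n "2 ^ Suc m"] n1 m by simp
    also have "\<dots> < e / c * ((2 ^ Suc m) powr a * real (Suc m) powr b)"
      using N[of "Suc m"] m by (simp add: pos_divide_less_eq)
    also have "\<dots> \<le> e / c * ((2 * real n) powr a * (2 / ln 2 * ln (real n)) powr b)"
    proof (intro mult_left_mono mult_mono powr_mono2)
      have "real (Suc m) \<le> 2 * real m" using m1 by simp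
      also have "\<dots> \<le> 2 / ln 2 * ln (real n)" using lnm by (simp add: field_simps)
      finally show "real (Suc m) \<le> 2 / ln 2 * ln (real n)" .
    qed (use a b e c n2 in auto)
    also have "\<dots> = e * (real n powr a * ln (real n) powr b)"
      using c lnpos by (simp add: c_def powr_mult powr_divide)
    finally show ?case using n1 lnpos by (simp add: pos_divide_less_eq)
  qed
qed

text \<open>
  Summable expectations make the sum of the variables integrable, hence almost surely finite, which
  replaces a Borel--Cantelli argument.
\<close>

lemma (in prob_space) AE_tendsto_0_if_summable_expectation:
  fixes Y :: "nat \<Rightarrow> 'a \<Rightarrow> real"
  assumes int: "\<And>m. integrable M (Y m)" and nn: "\<And>m \<omega>. 0 \<le> Y m \<omega>"
    and sm: "summable (\<lambda>m. expectation (Y m))"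
  shows "AE \<omega> in M. (\<lambda>m. Y m \<omega>) \<longlonglongrightarrow> 0"
proof -
  have "(\<integral>\<^sup>+ \<omega>. (\<Sum>m. ennreal (Y m \<omega>)) \<partial>M) = (\<Sum>m. \<integral>\<^sup>+ \<omega>. ennreal (Y m \<omega>) \<partial>M)"
    using int by (intro nn_integral_suminf) auto
  also have "\<dots> = (\<Sum>m. ennreal (expectation (Y m)))"
    using int nn by (simp add: nn_integral_eq_integral)
  also have "\<dots> = ennreal (\<Sum>m. expectation (Y m))"
    using sm nn by (intro suminf_ennreal2 integral_nonneg) auto
  finally have "(\<integral>\<^sup>+ \<omega>. (\<Sum>m. ennreal (Y m \<omega>)) \<partial>M) \<noteq> \<infinity>" by simp
  moreover have "(\<lambda>\<omega>. \<Sum>m. ennreal (Y m \<omega>)) \<in> borel_measurable M"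
    using borel_measurable_integrable[OF int] by measurable
  ultimately have "AE \<omega> in M. (\<Sum>m. ennreal (Y m \<omega>)) \<noteq> \<infinity>"
    by (intro nn_integral_PInf_AE)
  then show ?thesis
  proof eventually_elim
    case (elim \<omega>)
    then have "summable (\<lambda>m. Y m \<omega>)" using nn by (intro summable_suminf_not_top) auto
    then show ?case by (rule summable_LIMSEQ_zero)
  qed
qed

section \<open>The generating function of the step distribution\<close>

lemma expectation_nat_pmf:
  fixes g :: "nat \<Rightarrow> real"
  shows "integrable (measure_pmf p) g \<longleftrightarrow> summable (\<lambda>k. pmf p k * \<bar>g k\<bar>)"
    and "integrable (measure_pmf p) g \<Longrightarrow> (\<lambda>k. pmf p k * g k) sums measure_pmf.expectation p g"
proof -
  have int: "integrable (measure_pmf p) g \<longleftrightarrow> integrable (count_space UNIV) (\<lambda>k. pmf p k * g k)"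
    unfolding measure_pmf_eq_density by (subst integrable_density) auto
  then show "integrable (measure_pmf p) g \<longleftrightarrow> summable (\<lambda>k. pmf p k * \<bar>g k\<bar>)"
    by (simp add: integrable_count_space_nat_iff abs_mult)
  have "measure_pmf.expectation p g = integral\<^sup>L (count_space UNIV) (\<lambda>k. pmf p k * g k)"
    unfolding measure_pmf_eq_density by (subst integral_density) auto
  then show "(\<lambda>k. pmf p k * g k) sums measure_pmf.expectation p g" if "integrable (measure_pmf p) g"
    using sums_integral_count_space_nat that int by simp
qed

lemma pmf_sums_1: "pmf p sums (1::real)" for p :: "nat pmf"
  using expectation_nat_pmf(2)[of p "\<lambda>_. 1"] by simp

abbreviation pgf_summable :: "nat pmf \<Rightarrow> real \<Rightarrow> bool" where
  "pgf_summable p s \<equiv> summable (\<lambda>k. pmf p k * s ^ k)"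

lemma pgf_summable_mono:
  assumes "pgf_summable p r" "0 \<le> s" "s \<le> r"
  shows "pgf_summable p s"
  by (rule summable_comparison_test'[OF assms(1)])
     (use assms in \<open>auto intro!: mult_left_mono power_mono simp: abs_mult\<close>)

lemma pgf_summable_1: "pgf_summable p 1"
  using pmf_sums_1 by (simp add: sums_iff)

lemma pgf_summable_le_1: "0 \<le> s \<Longrightarrow> s \<le> 1 \<Longrightarrow> pgf_summable p s"
  using pgf_summable_mono[OF pgf_summable_1] .

lemma pgf_1: "pgf p 1 = 1"
  using pmf_sums_1 by (simp add: pgf_def sums_iff)

lemma pgf_0: "pgf p 0 = pmf p 0"
  by (simp add: pgf_def)

lemma powser_continuous_on:
  fixes a :: "nat \<Rightarrow> real"
  assumes "summable (\<lambda>k. a k * r ^ k)" "\<And>k. 0 \<le> a k"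
  shows "continuous_on {0..r} (\<lambda>s. \<Sum>k. a k * s ^ k)"
proof -
  have "uniform_limit {0..r} (\<lambda>n s. \<Sum>k<n. a k * s ^ k) (\<lambda>s. \<Sum>k. a k * s ^ k) sequentially"
    by (rule Weierstrass_m_test[OF _ assms(1)])
       (use assms(2) in \<open>auto intro!: mult_left_mono power_mono simp: abs_mult\<close>)
  then show ?thesis
    by (rule uniform_limit_theorem[rotated]) (auto intro!: always_eventually continuous_intros)
qed

lemma pgf_continuous_on:
  assumes "pgf_summable p r"
  shows "continuous_on {0..r} (pgf p)"
  unfolding pgf_def[abs_def] using assms by (rule powser_continuous_on) simp

lemma pgf_expectation:
  assumes "0 \<le> s" "s \<le> 1"
  shows "integrable (measure_pmf p) (\<lambda>z. s ^ z)" "measure_pmf.expectation p (\<lambda>z. s ^ z) = pgf p s"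
proof -
  show int: "integrable (measure_pmf p) (\<lambda>z. s ^ z)"
    unfolding expectation_nat_pmf(1) using pgf_summable_le_1[OF assms] assms by simp
  show "measure_pmf.expectation p (\<lambda>z. s ^ z) = pgf p s"
    using expectation_nat_pmf(2)[OF int] by (simp add: pgf_def sums_iff)
qed

lemma pgf_convex: "convex_on {0..1} (pgf p)"
proof (rule convex_onI)
  fix t x y :: real
  assume t: "0 < t" "t < 1" and xy: "x \<in> {0..1}" "y \<in> {0..1}"
  have le1: "(1 - t) * x + t * y \<in> {0..1}"
    using convex_real_interval(5)[of 0 1] t xy
    by (auto simp: convex_alt)
  have "pgf p ((1 - t) * x + t * y)
      \<le> (\<Sum>k. (1 - t) * (pmf p k * x ^ k) + t * (pmf p k * y ^ k))"
    unfolding pgf_def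
  proof (rule suminf_le)
    fix k
    have "convex_on {0::real..} (\<lambda>x. x ^ k)"
      by (cases "even k") (auto intro: convex_power_odd convex_on_subset[OF convex_power_even])
    from convex_onD[OF this, of t x y]
    have "((1 - t) * x + t * y) ^ k \<le> (1 - t) * x ^ k + t * y ^ k"
      using t xy by simp
    then have "pmf p k * ((1 - t) * x + t * y) ^ k \<le> pmf p k * ((1 - t) * x ^ k + t * y ^ k)"
      by (rule mult_left_mono) simp
    then show "pmf p k * ((1 - t) * x + t * y) ^ k \<le> (1 - t) * (pmf p k * x ^ k) + t * (pmf p k * y ^ k)"
      by (simp add: algebra_simps)
  qed (use le1 xy in \<open>auto intro!: pgf_summable_le_1 summable_add summable_mult\<close>)
  also have "\<dots> = (1 - t) * pgf p x + t * pgf p y"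
  proof -
    have x: "pgf_summable p x" and y: "pgf_summable p y" using xy by (auto intro: pgf_summable_le_1)
    show ?thesis
      using suminf_add[OF summable_mult[OF x, of "1 - t"] summable_mult[OF y, of t]]
        suminf_mult[OF x, of "1 - t"] suminf_mult[OF y, of t]
      by (simp add: pgf_def)
  qed
  finally show "pgf p ((1 - t) *\<^sub>R x + t *\<^sub>R y) \<le> (1 - t) * pgf p x + t * pgf p y" by simp
qed simp

text \<open>
  A convex function that is below the diagonal at both ends of an interval, strictly at one of
  them, is strictly below in between.
\<close>

lemma pgf_below_diagonal:
  assumes "0 \<le> x" "x < u" "u < y" "y \<le> 1"
    and "pgf p x \<le> x" "pgf p y \<le> y" "pgf p x < x \<or> pgf p y < y"
  shows "pgf p u < u"
proof -
  define t where "t = (u - x) / (y - x)"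
  have "t * (y - x) = u - x" using assms by (simp add: t_def)
  then have "u = (1 - t) * x + t * y" by (simp add: algebra_simps)
  moreover have "0 < t" "t < 1" using assms by (auto simp: t_def)
  ultimately have t: "0 < t" "t < 1" "u = (1 - t) * x + t * y" by auto
  have "pgf p u \<le> (1 - t) * pgf p x + t * pgf p y"
    using convex_onD[OF pgf_convex, of t x y p] t assms by simp
  also have "\<dots> < (1 - t) * x + t * y"
    using assms(5-7) t
    by (smt (verit) mult_left_mono mult_strict_left_mono)
  finally show ?thesis using t by simp
qed

text \<open>
  The quotient \<open>(1 - f(s)) / (1 - s)\<close> is at least \<open>\<Sum>k<K. p_k (1 + s + \<dots> + s^(k-1))\<close>, a continuous
  function whose value at \<open>1\<close> exceeds \<open>1\<close> once \<open>K\<close> is large.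
\<close>

lemma supercritical_below_diagonal:
  assumes int: "integrable (measure_pmf p) real" and E: "measure_pmf.expectation p real > 1"
  shows "\<exists>s. 0 < s \<and> s < 1 \<and> pgf p s < s"
proof -
  have "(\<lambda>n. \<Sum>k<n. pmf p k * real k) \<longlonglongrightarrow> measure_pmf.expectation p real"
    using expectation_nat_pmf(2)[OF int] by (simp add: sums_def)
  from order_tendstoD(1)[OF this E] obtain K where K: "(\<Sum>k<K. pmf p k * real k) > 1"
    by (auto simp: eventually_sequentially)
  define G where "G s = (\<Sum>k<K. pmf p k * (\<Sum>i<k. s ^ i))" for s :: real
  have "isCont G 1" unfolding G_def by (intro continuous_intros)
  then have "(G \<longlongrightarrow> G 1) (at_left 1)"
    by (simp add: isCont_def filterlim_at_split)
  moreover have "G 1 > 1" using K by (simp add: G_def)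
  ultimately have "\<forall>\<^sub>F s in at_left 1. G s > 1" by (rule order_tendstoD)
  moreover have "\<forall>\<^sub>F s in at_left (1::real). s \<in> {0<..<1}"
    by (rule eventually_at_left_real) simp
  ultimately have "\<forall>\<^sub>F s in at_left 1. G s > 1 \<and> s \<in> {0<..<1}" by eventually_elim auto
  then obtain s where s: "G s > 1" "0 < s" "s < 1"
    using eventually_happens'[OF trivial_limit_at_left_real] by fastforce
  have "(1 - s) * 1 < (1 - s) * G s" using s by simp
  also have "\<dots> = (\<Sum>k<K. pmf p k * (1 - s ^ k))"
    unfolding G_def
    by (subst sum_distrib_left, intro sum.cong refl) (simp add: one_diff_power_eq)
  also have "\<dots> \<le> (\<Sum>k. pmf p k * (1 - s ^ k))"
  proof (rule sum_le_suminf)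
    show "summable (\<lambda>k. pmf p k * (1 - s ^ k))"
      using summable_diff[OF pgf_summable_1[of p] pgf_summable_le_1[of s p]] s
      by (simp add: algebra_simps)
  qed (use s in \<open>auto simp: power_le_one\<close>)
  also have "\<dots> = pgf p 1 - pgf p s"
    unfolding pgf_def using suminf_diff[OF pgf_summable_1[of p] pgf_summable_le_1[of s p]] s
    by (simp add: algebra_simps)
  finally show ?thesis using s by (auto simp: pgf_1)
qed

text \<open>
  The intermediate value theorem gives a fixed point below the point of
  \<open>supercritical_below_diagonal\<close>; by convexity no smaller positive fixed point can exist, and the
  graph stays strictly below the diagonal up to \<open>1\<close>.
\<close>

lemma q_star_fixed_point:
  assumes p0: "0 < pmf p 0" and int: "integrable (measure_pmf p) real"
    and E: "measure_pmf.expectation p real > 1"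
  shows "0 < q_star p" "q_star p < 1" "pgf p (q_star p) = q_star p"
    and "\<And>u. q_star p < u \<Longrightarrow> u < 1 \<Longrightarrow> pgf p u < u"
proof -
  obtain s where s: "0 < s" "s < 1" "pgf p s < s"
    using supercritical_below_diagonal[OF int E] by blast
  have "continuous_on {0..s} (\<lambda>x. pgf p x - x)"
    using s by (intro continuous_intros pgf_continuous_on pgf_summable_le_1) auto
  then obtain q where q: "0 \<le> q" "q \<le> s" "pgf p q - q = 0"
    using IVT2'[of "\<lambda>x. pgf p x - x" s 0 0] s p0 by (auto simp: pgf_0)
  have q': "0 < q" "q < s" using q s p0 by (cases "q = 0"; cases "q = s"; force simp: pgf_0)+
  have "q_star p = q"
    unfolding q_star_def
  proof (rule Least_equality)
    fix y assume y: "0 < y \<and> pgf p y = y"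
    show "q \<le> y"
    proof (rule ccontr)
      assume "\<not> q \<le> y"
      then have "pgf p q < q"
        using pgf_below_diagonal[of y q s p] y q' s by simp
      then show False using q by simp
    qed
  qed (use q q' in auto)
  then show "0 < q_star p" "q_star p < 1" "pgf p (q_star p) = q_star p"
    using q q' s by auto
  show "pgf p u < u" if "q_star p < u" "u < 1" for u
  proof -
    consider "u < s" | "u = s" | "s < u" by linarith
    then show ?thesis
    proof cases
      case 1
      then show ?thesis using pgf_below_diagonal[of q u s p] q q' s that \<open>q_star p = q\<close> by simp
    next
      case 3
      then show ?thesis using pgf_below_diagonal[of s u 1 p] s that by (simp add: pgf_1)
    qed (use s in simp)
  qed
qed

section \<open>Contraction and the geometric law\<close>

text \<open>
  The unit ball of the weighted Lipschitz seminorm; it is used with \<open>s = 1/u\<close>.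
\<close>

definition slope_bounded :: "real \<Rightarrow> (nat \<Rightarrow> real) \<Rightarrow> bool" where
  "slope_bounded s h \<longleftrightarrow> (\<forall>k. \<bar>h (Suc k) - h k\<bar> \<le> s ^ k)"

text \<open>
  Run the chain from \<open>k\<close> and \<open>k + 1\<close> with the same step \<open>z\<close>: the two children keep distance one if
  \<open>z \<le> k\<close> and coincide otherwise. In the first case the weight of the increment is
  \<open>u^(-(k + 1 - z))\<close>, and averaging \<open>u^z\<close> produces \<open>f(u)\<close>.
\<close>

lemma child_mean_contracts_slope:
  assumes u: "0 < u" "u < 1" and h: "slope_bounded (1 / u) h"
  shows "\<bar>child_mean p h (Suc k) - child_mean p h k\<bar> \<le> pgf p u / u * (1 / u) ^ k"
proof -
  let ?d = "\<lambda>z. h (Suc (Suc k - z)) - h (Suc (k - z))"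
  have bound: "\<bar>?d z\<bar> \<le> (1 / u) ^ Suc k * u ^ z" for z
  proof (cases "z \<le> k")
    case True
    then have "\<bar>?d z\<bar> \<le> (1 / u) ^ (Suc k - z)"
      using h[unfolded slope_bounded_def, rule_format, of "Suc (k - z)"] by (simp add: Suc_diff_le)
    also have "\<dots> = (1 / u) ^ Suc k * u ^ z"
      using u True by (simp add: power_diff power_divide)
    finally show ?thesis .
  qed (use u in auto)
  have int: "integrable (measure_pmf p) ?d"
    by (intro Bochner_Integration.integrable_diff integrable_truncated_diff[of p "\<lambda>i. h (Suc i)"])
  have "child_mean p h (Suc k) - child_mean p h k = measure_pmf.expectation p ?d"
    unfolding child_mean_def
    by (intro Bochner_Integration.integral_diff[symmetric] integrable_truncated_diff[of p "\<lambda>i. h (Suc i)"])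
  also have "\<bar>\<dots>\<bar> \<le> measure_pmf.expectation p (\<lambda>z. \<bar>?d z\<bar>)"
    by (rule integral_abs_bound)
  also have "\<dots> \<le> measure_pmf.expectation p (\<lambda>z. (1 / u) ^ Suc k * u ^ z)"
    using u bound int
    by (intro integral_mono integrable_abs pgf_expectation integrable_mult_right) auto
  also have "\<dots> = pgf p u / u * (1 / u) ^ k"
    using pgf_expectation[of u p] u by simp
  finally show ?thesis .
qed

text \<open>
  The mean of \<open>h\<close> under the law with weights \<open>(1 - q) q^(k-1)\<close>, \<open>k \<ge> 1\<close>, written with summation by
  parts: only increments of \<open>h\<close> enter, which is what the seminorm controls.
\<close>

definition geometric_law_mean :: "real \<Rightarrow> (nat \<Rightarrow> real) \<Rightarrow> real" where
  "geometric_law_mean q h = h 1 + (\<Sum>m. q ^ Suc m * (h (Suc (Suc m)) - h (Suc m)))"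

lemma slope_bounded_summable:
  assumes "0 < q" "q < u" "slope_bounded (1 / u) h"
  shows "summable (\<lambda>m. \<bar>q ^ m * (h (Suc (Suc m)) - h (Suc m))\<bar>)"
    "\<bar>\<Sum>m. q ^ Suc m * (h (Suc (Suc m)) - h (Suc m))\<bar> \<le> q / (u - q)"
proof -
  have bound: "\<bar>q ^ m * (h (Suc (Suc m)) - h (Suc m))\<bar> \<le> (1 / u) * (q / u) ^ m" for m
  proof -
    have "\<bar>q ^ m * (h (Suc (Suc m)) - h (Suc m))\<bar> \<le> q ^ m * (1 / u) ^ Suc m"
      using assms(1) assms(3)[unfolded slope_bounded_def, rule_format, of "Suc m"]
      by (simp only: abs_mult power_abs abs_of_pos) (rule mult_left_mono, auto)
    then show ?thesis by (simp add: power_divide)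
  qed
  have geom: "(\<lambda>m. (1 / u) * (q / u) ^ m) sums ((1 / u) * (1 / (1 - q / u)))"
    using assms by (intro sums_mult geometric_sums) auto
  show sm: "summable (\<lambda>m. \<bar>q ^ m * (h (Suc (Suc m)) - h (Suc m))\<bar>)"
    by (rule summable_comparison_test'[OF sums_summable[OF geom], of 0]) (use bound in simp)
  have sm': "summable (\<lambda>m. \<bar>q ^ Suc m * (h (Suc (Suc m)) - h (Suc m))\<bar>)"
    using summable_mult[OF sm, of q] assms by (simp add: abs_mult mult.assoc)
  have "\<bar>\<Sum>m. q ^ Suc m * (h (Suc (Suc m)) - h (Suc m))\<bar> \<le> (\<Sum>m. \<bar>q ^ Suc m * (h (Suc (Suc m)) - h (Suc m))\<bar>)"
    by (rule summable_rabs[OF sm'])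
  also have "\<dots> \<le> (\<Sum>m. q * ((1 / u) * (q / u) ^ m))"
    using mult_left_mono[OF bound, of q] assms
    by (intro suminf_le sm' summable_mult sums_summable[OF geom]) (auto simp: abs_mult mult.assoc)
  also have "\<dots> = q * ((1 / u) * (1 / (1 - q / u)))"
    using sums_mult[OF geom, of q] by (simp add: sums_iff)
  also have "\<dots> = q / (u - q)" using assms by (simp add: field_simps)
  finally show "\<bar>\<Sum>m. q ^ Suc m * (h (Suc (Suc m)) - h (Suc m))\<bar> \<le> q / (u - q)" .
qed

text \<open>
  The increments of \<open>child_mean p h\<close> are the convolution of \<open>p\<close> with the increments of \<open>h\<close>, so the
  generating function of the former at \<open>q\<close> is \<open>f(q) = q\<close> times that of the latter.
\<close>

lemma geometric_law_mean_invariant: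
  assumes q: "0 < q" "q < u" "u < 1" and fp: "pgf p q = q" and h: "slope_bounded (1 / u) h"
  shows "geometric_law_mean q (child_mean p h) = geometric_law_mean q h"
proof -
  let ?g = "\<lambda>j. h (Suc (Suc j)) - h (Suc j)"
  let ?G = "\<lambda>j. \<Sum>z\<le>j. pmf p z * ?g (j - z)"
  have diff: "measure_pmf.expectation p (\<lambda>z. h (Suc (Suc j - z)) - h (Suc (j - z))) = ?G j" for j
  proof -
    have "measure_pmf.expectation p (\<lambda>z. h (Suc (Suc j - z)) - h (Suc (j - z)))
        = (\<Sum>z\<le>j. (h (Suc (Suc j - z)) - h (Suc (j - z))) * pmf p z)"
      by (rule integral_measure_pmf_real) (auto intro: ccontr)
    then show ?thesis by (simp add: Suc_diff_le mult.commute)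
  qed
  have step: "child_mean p h (Suc j) - child_mean p h j = ?G j" for j
    unfolding diff[symmetric] child_mean_def
    by (intro Bochner_Integration.integral_diff[symmetric] integrable_truncated_diff[of p "\<lambda>i. h (Suc i)"])
  have "(\<lambda>j. \<Sum>z\<le>j. (pmf p z * q ^ z) * (q ^ (j - z) * ?g (j - z)))
      sums ((\<Sum>z. pmf p z * q ^ z) * (\<Sum>m. q ^ m * ?g m))"
    using pgf_summable_le_1[of q p] q slope_bounded_summable(1)[OF q(1,2) h]
    by (intro Cauchy_product_sums) auto
  moreover have "(\<Sum>z\<le>j. (pmf p z * q ^ z) * (q ^ (j - z) * ?g (j - z))) = q ^ j * ?G j" for j
    unfolding sum_distrib_left
  proof (rule sum.cong[OF refl])
    fix z assume "z \<in> {..j}"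
    then have "q ^ j = q ^ z * q ^ (j - z)" by (simp flip: power_add)
    then show "(pmf p z * q ^ z) * (q ^ (j - z) * ?g (j - z)) = q ^ j * (pmf p z * ?g (j - z))"
      by simp
  qed
  ultimately have G_sums: "(\<lambda>j. q ^ j * ?G j) sums (q * (\<Sum>m. q ^ m * ?g m))"
    using fp by (simp add: pgf_def)
  have "(\<lambda>j. q ^ Suc j * ?G (Suc j)) sums (q * (\<Sum>m. q ^ m * ?g m) - ?G 0)"
    using G_sums sums_Suc_iff[of "\<lambda>j. q ^ j * ?G j"] by simp
  then have "(\<Sum>m. q ^ Suc m * ?G (Suc m)) = q * (\<Sum>m. q ^ m * ?g m) - ?G 0"
    by (rule sums_unique[symmetric])
  moreover have "child_mean p h 1 = h 1 + ?G 0"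
    using step[of 0] by (simp add: child_mean_def)
  moreover have "q * (\<Sum>m. q ^ m * ?g m) = (\<Sum>m. q ^ Suc m * ?g m)"
    using suminf_mult[OF summable_rabs_cancel[OF slope_bounded_summable(1)[OF q(1,2) h]], of q] by (simp add: mult.assoc)
  ultimately show ?thesis unfolding geometric_law_mean_def step by simp
qed

lemma geometric_law_mean_cmult: "geometric_law_mean q (\<lambda>k. c * h k) = c * geometric_law_mean q h"
  if "0 < q" "q < u" "slope_bounded (1 / u) h"
proof -
  have "summable (\<lambda>m. q ^ Suc m * (h (Suc (Suc m)) - h (Suc m)))"
    using summable_mult[OF summable_rabs_cancel[OF slope_bounded_summable(1)[OF that]], of q] by (simp add: mult.assoc)
  from suminf_mult[OF this, of c] show ?thesis
    unfolding geometric_law_mean_def by (simp add: algebra_simps)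
qed

text \<open>
  Centring removes the additive constant that the seminorm does not see, so the seminorm then controls
  the function itself.
\<close>

lemma slope_bounded_deviation:
  assumes "0 < q" "q < u" "u < 1" "slope_bounded (1 / u) h"
  shows "\<bar>h k - geometric_law_mean q h\<bar> \<le> (1 / (1 / u - 1) + 1 + q / (u - q)) * (1 / u) ^ k"
proof -
  have s: "1 < 1 / u" using assms by simp
  have h0: "\<bar>h j - h 0\<bar> \<le> ((1 / u) ^ j - 1) / (1 / u - 1)" for j
  proof (induction j)
    case (Suc j)
    have "\<bar>h (Suc j) - h 0\<bar> \<le> (1 / u) ^ j + ((1 / u) ^ j - 1) / (1 / u - 1)"
      using Suc assms(4)[unfolded slope_bounded_def, rule_format, of j] by linarith
    also have "\<dots> = ((1 / u) ^ Suc j - 1) / (1 / u - 1)"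
    proof -
      have "s ^ j + (s ^ j - 1) / (s - 1) = (s ^ Suc j - 1) / (s - 1)" if "1 < s" for s :: real
        using that by (simp add: field_simps)
      then show ?thesis using s by blast
    qed
    finally show ?case .
  qed simp
  have h1: "\<bar>h 1 - h 0\<bar> \<le> 1" using h0[of 1] s by (simp split: if_splits)
  have pw: "1 \<le> (1 / u) ^ k" using s by (intro one_le_power) simp
  have "\<bar>h k - geometric_law_mean q h\<bar> \<le> ((1 / u) ^ k - 1) / (1 / u - 1) + 1 + q / (u - q)"
    using h0[of k] h1 slope_bounded_summable(2)[OF assms(1,2,4)]
    unfolding geometric_law_mean_def by linarith
  also have "\<dots> \<le> (1 / u) ^ k / (1 / u - 1) + (1 / u) ^ k + q / (u - q) * (1 / u) ^ k"
    using s pw assms mult_left_mono[OF pw, of "q / (u - q)"]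
    by (intro add_mono divide_right_mono) auto
  finally show ?thesis by (simp add: algebra_simps)
qed

lemma child_mean_exponential_drift:
  assumes w: "0 < w" "w < 1"
  shows "child_mean p (\<lambda>k. (1 / w) ^ k) k \<le> pgf p w / w * (1 / w) ^ k + 1 / w"
proof -
  have "(1 / w) ^ Suc (k - z) \<le> (1 / w) ^ Suc k * w ^ z + 1 / w" for z
    using w by (cases "z \<le> k") (auto simp: power_diff power_divide)
  then have "child_mean p (\<lambda>k. (1 / w) ^ k) k \<le> measure_pmf.expectation p (\<lambda>z. (1 / w) ^ Suc k * w ^ z + 1 / w)"
    unfolding child_mean_def using w pgf_expectation[of w p]
    by (intro integral_mono integrable_truncated_diff[of p "\<lambda>i. (1 / w) ^ Suc i"]
        Bochner_Integration.integrable_add integrable_mult_right) auto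
  also have "\<dots> = (1 / w) ^ Suc k * pgf p w + 1 / w"
    using w pgf_expectation[of w p] by simp
  finally show ?thesis by (simp add: mult.commute)
qed

section \<open>Concentration of the root degree\<close>

context backward_step_model
begin

text \<open>
  The exponential function of the depth has multiplicative drift \<open>f(w)/w < 1\<close> up to a constant, so its
  average over the vertices remains bounded.
\<close>

lemma exponential_moment_bounded:
  assumes w: "0 < w" "w < 1" "pgf p w < w"
  obtains B where "\<And>n. 1 \<le> n \<Longrightarrow>
    expectation (\<lambda>\<omega>. depth_sum (child_mean p (\<lambda>k. (1 / w) ^ k)) (depth_list n \<omega>)) \<le> B * real (Suc n)"
proof -
  define \<psi> where "\<psi> k = (1 / w) ^ k" for k :: nat
  define l where "l = pgf p w / w"
  have l: "l < 1" using w by (simp add: l_def)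
  have "0 \<le> pgf p w" unfolding pgf_def using w by (intro suminf_nonneg pgf_summable_le_1) auto
  then have l0: "0 \<le> l" using w by (simp add: l_def)
  \<comment> \<open>the fixed point of \<open>B = l B + 1/w\<close>, raised to cover the first list \<open>[0, 1]\<close>\<close>
  define B where "B = max (1 / w) (1 / w / (1 - l))"
  have B: "1 / w \<le> B" "l * B + 1 / w \<le> B"
  proof -
    show "1 / w \<le> B" by (simp add: B_def)
    have "1 / w / (1 - l) \<le> B" by (simp add: B_def)
    then have "1 / w \<le> B * (1 - l)" using l by (subst (asm) pos_divide_le_eq) auto
    then show "l * B + 1 / w \<le> B" by (simp add: algebra_simps)
  qed
  have drift: "expectation (\<lambda>\<omega>. depth_sum (child_mean p \<psi>) (depth_list n \<omega>))
      \<le> l * expectation (\<lambda>\<omega>. depth_sum \<psi> (depth_list n \<omega>)) + 1 / w * real (Suc n)" for n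
  proof -
    have "expectation (\<lambda>\<omega>. depth_sum (child_mean p \<psi>) (depth_list n \<omega>))
        \<le> expectation (\<lambda>\<omega>. depth_sum (\<lambda>k. l * \<psi> k + 1 / w) (depth_list n \<omega>))"
      unfolding \<psi>_def l_def
      by (intro integral_mono integrable_depth_list depth_sum_mono child_mean_exponential_drift w)
    then show ?thesis
      by (simp add: depth_sum_add depth_sum_cmult depth_sum_const integrable_depth_list prob_space)
  qed
  have moment: "expectation (\<lambda>\<omega>. depth_sum \<psi> (depth_list n \<omega>)) \<le> B * real (Suc n)" if "1 \<le> n" for n
    using that
  proof (induction n rule: nat_induct_at_least)
    case base
    have "1 \<le> 1 / w" using w by simp
    then have "1 + 1 / w \<le> B * 2" using B(1) by linarith
    then show ?case by (simp add: depth_list_1 depth_sum_def \<psi>_def prob_space)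
  next
    case (Suc n)
    have "expectation (\<lambda>\<omega>. depth_sum (child_mean p \<psi>) (depth_list n \<omega>)) \<le> l * (B * real (Suc n)) + 1 / w * real (Suc n)"
      using drift[of n] mult_left_mono[OF Suc.IH l0] by linarith
    also have "\<dots> = (l * B + 1 / w) * real (Suc n)" by (simp add: algebra_simps)
    also have "\<dots> \<le> B * real (Suc n)" using B(2) by (intro mult_right_mono) auto
    finally have "expectation (\<lambda>\<omega>. depth_sum (child_mean p \<psi>) (depth_list n \<omega>)) / real (Suc n) \<le> B"
      by (simp add: pos_divide_le_eq)
    then show ?case
      using Suc.IH expectation_depth_sum_step[OF Suc.hyps, of \<psi>] by (simp add: algebra_simps)
  qed
  show ?thesis
  proof (rule that)
    fix n :: nat assume n: "1 \<le> n"
    have "expectation (\<lambda>\<omega>. depth_sum (child_mean p \<psi>) (depth_list n \<omega>)) \<le> l * (B * real (Suc n)) + 1 / w * real (Suc n)"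
      using drift[of n] mult_left_mono[OF moment[OF n] l0] by linarith
    also have "\<dots> = (l * B + 1 / w) * real (Suc n)" by (simp add: algebra_simps)
    also have "\<dots> \<le> B * real (Suc n)" using B(2) by (intro mult_right_mono) auto
    finally show "expectation (\<lambda>\<omega>. depth_sum (child_mean p (\<lambda>k. (1 / w) ^ k)) (depth_list n \<omega>)) \<le> B * real (Suc n)"
      by (simp add: \<psi>_def[abs_def])
  qed
qed

text \<open>
  The bound is proved for all \<open>h\<close> in the unit ball at once, because the recursion for \<open>h\<close> involves
  \<open>child_mean p h\<close>. The latter is \<open>l\<close> times another element \<open>h'\<close> of the ball, and its centring is
  inherited by invariance. The arithmetic-geometric mean inequality bounds the cross term by \<open>l\<close> times
  the two second moments, which gives the recursion \<open>y_{n+1} \<le> (1 + 2 l / (n+1)) y_n + C\<close>; since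
  \<open>l < 1\<close>, its solutions are \<open>O(n^(1 + l))\<close>.
\<close>

lemma second_moment_bound:
  assumes q: "0 < q" "q < u" "u < 1" "pgf p q = q"
    and u: "0 < pgf p u" "pgf p u < u" "pgf p (u\<^sup>2) < u\<^sup>2"
  obtains K where "\<And>n h. 1 \<le> n \<Longrightarrow> slope_bounded (1 / u) h \<Longrightarrow>
    expectation (\<lambda>\<omega>. (depth_sum (\<lambda>k. h k - geometric_law_mean q h) (depth_list n \<omega>))\<^sup>2)
      \<le> K * real n powr (1 + pgf p u / u)"
proof -
  define l where "l = pgf p u / u"
  have l: "0 < l" "l < 1" using u q by (auto simp: l_def)
  have w: "0 < u\<^sup>2" "u\<^sup>2 < 1" using q by (auto simp: power_less_one_iff)
  obtain B where B: "\<And>n. 1 \<le> n \<Longrightarrow>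
      expectation (\<lambda>\<omega>. depth_sum (child_mean p (\<lambda>k. (1 / u\<^sup>2) ^ k)) (depth_list n \<omega>)) \<le> B * real (Suc n)"
    using exponential_moment_bounded[OF w u(3)] by blast
  define c0 where "c0 = 1 / (1 / u - 1) + 1 + q / (u - q)"
  have c0: "0 \<le> c0" using q by (simp add: c0_def)
  define t where "t h k = h k - geometric_law_mean q h" for h :: "nat \<Rightarrow> real" and k
  have t_le: "\<bar>t h k\<bar> \<le> c0 * (1 / u) ^ k" if "slope_bounded (1 / u) h" for h k
    unfolding t_def c0_def using slope_bounded_deviation[OF q(1-3) that] .
  have t2_le: "(t h k)\<^sup>2 \<le> c0\<^sup>2 * (1 / u\<^sup>2) ^ k" if "slope_bounded (1 / u) h" for h k
  proof -
    have "(t h k)\<^sup>2 \<le> (c0 * (1 / u) ^ k)\<^sup>2"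
      using power_mono[OF t_le[OF that] abs_ge_zero, of k 2] by simp
    then show ?thesis by (simp add: power_mult_distrib power_divide flip: power_mult) (simp add: mult.commute)
  qed
  define C where "C = c0\<^sup>2 * B"
  have noise: "expectation (\<lambda>\<omega>. depth_sum (child_mean p (\<lambda>k. (t h k)\<^sup>2)) (depth_list n \<omega>)) / real (Suc n) \<le> C"
    if n: "1 \<le> n" and h: "slope_bounded (1 / u) h" for n h
  proof -
    have "expectation (\<lambda>\<omega>. depth_sum (child_mean p (\<lambda>k. (t h k)\<^sup>2)) (depth_list n \<omega>))
        \<le> expectation (\<lambda>\<omega>. depth_sum (\<lambda>k. c0\<^sup>2 * child_mean p (\<lambda>k. (1 / u\<^sup>2) ^ k) k) (depth_list n \<omega>))"
      unfolding child_mean_cmult[symmetric]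
      by (intro integral_mono integrable_depth_list depth_sum_mono child_mean_mono t2_le h)
    also have "\<dots> \<le> c0\<^sup>2 * (B * real (Suc n))"
      using B[OF n] by (simp add: depth_sum_cmult mult_left_mono)
    finally show ?thesis by (simp add: C_def pos_divide_le_eq mult.assoc)
  qed
  \<comment> \<open>the first entry covers \<open>n = 1\<close>; the second lets the growth of the bound absorb the noise \<open>C\<close>\<close>
  define K where "K = max ((c0 * (1 + 1 / u))\<^sup>2) (2 * C / (1 - l))"
  have K: "(c0 * (1 + 1 / u))\<^sup>2 \<le> K" "2 * C \<le> K * (1 - l)" "0 \<le> K"
  proof -
    show 1: "(c0 * (1 + 1 / u))\<^sup>2 \<le> K" by (simp add: K_def)
    then show "0 \<le> K" using zero_le_power2 order_trans by blast
    have "2 * C / (1 - l) \<le> K" by (simp add: K_def)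
    then show "2 * C \<le> K * (1 - l)" using l by (simp add: pos_divide_le_eq)
  qed
  have main: "expectation (\<lambda>\<omega>. (depth_sum (t h) (depth_list n \<omega>))\<^sup>2) \<le> K * real n powr (1 + l)"
    if n: "1 \<le> n" and h: "slope_bounded (1 / u) h" for n h
    using n h
  proof (induction n arbitrary: h rule: nat_induct_at_least)
    case base
    have "\<bar>t h 0 + t h 1\<bar> \<le> c0 * (1 + 1 / u)"
      using t_le[OF base, of 0] t_le[OF base, of 1] by (simp add: algebra_simps)
    then have "(t h 0 + t h 1)\<^sup>2 \<le> (c0 * (1 + 1 / u))\<^sup>2"
      by (rule power2_le_iff_abs_le[THEN iffD2, rotated]) (use c0 q in auto)
    then show ?case using K(1) by (simp add: depth_list_1 depth_sum_def prob_space)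
  next
    case (Suc n h)
    define h' where "h' k = child_mean p h k / l" for k
    have h': "slope_bounded (1 / u) h'"
      unfolding slope_bounded_def
    proof
      fix k
      have "\<bar>child_mean p h (Suc k) - child_mean p h k\<bar> \<le> l * (1 / u) ^ k"
        using child_mean_contracts_slope[of u h p k] q Suc.prems by (simp add: l_def)
      then show "\<bar>h' (Suc k) - h' k\<bar> \<le> (1 / u) ^ k"
        using l by (simp add: h'_def diff_divide_distrib[symmetric] pos_divide_le_eq mult.commute)
    qed
    have kh: "child_mean p h = (\<lambda>k. l * h' k)" using l by (simp add: h'_def fun_eq_iff)
    have "geometric_law_mean q h = l * geometric_law_mean q h'"
      using geometric_law_mean_invariant[OF q Suc.prems] geometric_law_mean_cmult[OF q(1,2) h', of l]
      by (simp add: kh)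
    then have kt: "child_mean p (t h) = (\<lambda>k. l * t h' k)"
      unfolding t_def[abs_def] by (rule_tac ext) (simp add: child_mean_diff kh algebra_simps)
    let ?E = "\<lambda>h. expectation (\<lambda>\<omega>. (depth_sum (t h) (depth_list n \<omega>))\<^sup>2)"
    let ?P = "K * real n powr (1 + l)"
    \<comment> \<open>\<open>2 x y \<le> x\<^sup>2 + y\<^sup>2\<close>, with the induction hypothesis for both \<open>h\<close> and \<open>h'\<close>\<close>
    have cross: "2 * expectation (\<lambda>\<omega>. depth_sum (t h) (depth_list n \<omega>) * depth_sum (child_mean p (t h)) (depth_list n \<omega>))
        \<le> 2 * l * ?P"
    proof -
      have "2 * expectation (\<lambda>\<omega>. depth_sum (t h) (depth_list n \<omega>) * depth_sum (child_mean p (t h)) (depth_list n \<omega>))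
          = l * expectation (\<lambda>\<omega>. 2 * depth_sum (t h) (depth_list n \<omega>) * depth_sum (t h') (depth_list n \<omega>))"
        by (simp add: kt depth_sum_cmult mult.left_commute mult.assoc)
      also have "\<dots> \<le> l * expectation (\<lambda>\<omega>. (depth_sum (t h) (depth_list n \<omega>))\<^sup>2 + (depth_sum (t h') (depth_list n \<omega>))\<^sup>2)"
        using l integrable_depth_list[of "\<lambda>xs. 2 * depth_sum (t h) xs * depth_sum (t h') xs" n]
          integrable_depth_list[of "\<lambda>xs. (depth_sum (t h) xs)\<^sup>2 + (depth_sum (t h') xs)\<^sup>2" n]
        by (intro mult_left_mono integral_mono sum_squares_bound) auto
      also have "\<dots> = l * (?E h + ?E h')"
        by (subst Bochner_Integration.integral_add)
           (auto intro: integrable_depth_list[of "\<lambda>xs. (depth_sum _ xs)\<^sup>2"])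
      also have "\<dots> \<le> l * (?P + ?P)"
        using l by (intro mult_left_mono add_mono Suc.IH Suc.prems h') auto
      finally show ?thesis by simp
    qed
    have "expectation (\<lambda>\<omega>. (depth_sum (t h) (depth_list (Suc n) \<omega>))\<^sup>2)
        = expectation (\<lambda>\<omega>. (depth_sum (t h) (depth_list n \<omega>))\<^sup>2
            + 2 * (depth_sum (t h) (depth_list n \<omega>) * depth_sum (child_mean p (t h)) (depth_list n \<omega>)) / real (Suc n)
            + depth_sum (child_mean p (\<lambda>k. (t h k)\<^sup>2)) (depth_list n \<omega>) / real (Suc n))"
      using expectation_step[OF Suc.hyps, of "\<lambda>xs. (depth_sum (t h) xs)\<^sup>2"]
      by (simp add: avg_next_depth_sum_square mult.assoc)
    also have "\<dots> = ?E h
        + 2 * expectation (\<lambda>\<omega>. depth_sum (t h) (depth_list n \<omega>) * depth_sum (child_mean p (t h)) (depth_list n \<omega>)) / real (Suc n)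
        + expectation (\<lambda>\<omega>. depth_sum (child_mean p (\<lambda>k. (t h k)\<^sup>2)) (depth_list n \<omega>)) / real (Suc n)"
      using integrable_depth_list[of "\<lambda>xs. (depth_sum (t h) xs)\<^sup>2" n]
        integrable_depth_list[of "\<lambda>xs. depth_sum (t h) xs * depth_sum (child_mean p (t h)) xs" n]
        integrable_depth_list[of "depth_sum (child_mean p (\<lambda>k. (t h k)\<^sup>2))" n]
      by simp
    also have "\<dots> \<le> ?P + 2 * l * ?P / real (Suc n) + C"
      using Suc.IH[OF Suc.prems] noise[OF Suc.hyps Suc.prems] cross
      by (intro add_mono divide_right_mono) auto
    also have "\<dots> \<le> ?P * (1 + (1 + l) / real (Suc n))"
    proof -
      have "real n powr 1 \<le> real n powr (1 + l)" using Suc.hyps l by (intro powr_mono) auto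
      then have n: "real n \<le> real n powr (1 + l)" using Suc.hyps by simp
      have "2 * C * real n \<le> K * (1 - l) * real n" by (rule mult_right_mono[OF K(2)]) simp
      also have "\<dots> \<le> K * (1 - l) * real n powr (1 + l)" using n K l by (intro mult_left_mono) auto
      finally have Kn: "2 * C * real n \<le> ?P * (1 - l)" by (simp add: algebra_simps)
      have 1: "C * real (Suc n) \<le> ?P * (1 - l)" if "0 \<le> C"
      proof -
        have "C * real (Suc n) \<le> C * (2 * real n)"
          using that Suc.hyps by (intro mult_left_mono) auto
        then show ?thesis using Kn by simp
      qed
      have 2: "C * real (Suc n) \<le> ?P * (1 - l)" if "C < 0"
        using that K l by (smt (verit) mult_nonneg_nonneg mult_neg_pos of_nat_0_less_iff powr_ge_zero zero_less_Suc)
      have "C * real (Suc n) \<le> ?P * (1 - l)" using 1 2 by linarith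
      then have "C \<le> ?P * (1 - l) / real (Suc n)" by (simp add: pos_le_divide_eq)
      moreover have "?P * (1 + (1 + l) / real (Suc n))
          = ?P + 2 * l * ?P / real (Suc n) + ?P * (1 - l) / real (Suc n)"
        unfolding add_divide_distrib[symmetric] add.assoc by (simp add: algebra_simps add_divide_distrib diff_divide_distrib)
      ultimately show ?thesis by linarith
    qed
    also have "\<dots> \<le> K * real (Suc n) powr (1 + l)"
      using mult_left_mono[OF powr_growth_step[of "1 + l" n] K(3)] l Suc.hyps by (simp add: mult.assoc)
    finally show ?case .
  qed
  show ?thesis using that main unfolding t_def l_def by blast
qed

text \<open>
  Apply the second moment bound to the indicator of depth \<open>1\<close>, whose mean under the geometric law is
  \<open>1 - q_*\<close>.
\<close>

lemma root_degree_in_probability: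
  assumes p0: "0 < pmf p 0" and int: "integrable (measure_pmf p) real"
    and E: "measure_pmf.expectation p real > 1"
  shows "tendsto_in_prob M (\<lambda>n \<omega>. real (root_degree V Z n \<omega>) / real n) (1 - q_star p)"
proof -
  define q where "q = q_star p"
  note qs = q_star_fixed_point[OF p0 int E, folded q_def]
  \<comment> \<open>\<open>u\<close> must exceed \<open>q\<close> for the contraction, and \<open>u\<^sup>2\<close> must exceed \<open>q\<close> for the second
    moment of \<open>u^(-depth)\<close>\<close>
  define u where "u = sqrt ((1 + q) / 2)"
  have u2: "u\<^sup>2 = (1 + q) / 2" "0 < u" using qs by (auto simp: u_def)
  have u2': "q < u\<^sup>2" "u\<^sup>2 < 1" using qs by (auto simp: u2)
  have u1: "u < 1" using u2' u2(2) by (simp add: power_less_one_iff)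
  have "u\<^sup>2 < u" using u1 u2(2) by (simp add: power2_eq_square)
  then have qu: "q < u" using u2' by simp
  have "pmf p 0 * u ^ 0 \<le> pgf p u"
    unfolding pgf_def using u1 u2(2) sum_le_suminf[of "\<lambda>k. pmf p k * u ^ k" "{0}"] pgf_summable_le_1[of u p]
    by simp
  then have pos: "0 < pgf p u" using p0 by simp
  obtain K where K: "\<And>n h. 1 \<le> n \<Longrightarrow> slope_bounded (1 / u) h \<Longrightarrow>
    expectation (\<lambda>\<omega>. (depth_sum (\<lambda>k. h k - geometric_law_mean q h) (depth_list n \<omega>))\<^sup>2)
      \<le> K * real n powr (1 + pgf p u / u)"
    using second_moment_bound[OF qs(1) qu u1 qs(3) pos] qs(4) qu u1 u2' by metis
  define l where "l = pgf p u / u"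
  have l: "l < 1" using qs(4)[OF qu u1] u2(2) by (simp add: l_def)
  have sb: "slope_bounded (1 / u) (indicator {1})"
    using u1 u2(2) by (auto simp: slope_bounded_def indicator_def one_le_power)
  have gm: "geometric_law_mean q (indicator {1}) = 1 - q"
  proof -
    have "(\<lambda>m. q ^ Suc m * (indicator {1} (Suc (Suc m)) - indicator {1} (Suc m)))
        = (\<lambda>m. if m = 0 then - q else 0)"
      by (auto simp: fun_eq_iff indicator_def)
    then have "(\<Sum>m. q ^ Suc m * (indicator {1} (Suc (Suc m)) - indicator {1} (Suc m))) = - q"
      using sums_single[of 0 "\<lambda>_. - q"] by (simp add: sums_iff)
    then show ?thesis by (simp add: geometric_law_mean_def)
  qed
  define T where "T xs = depth_sum (\<lambda>k. indicator {1} k - (1 - q)) xs" for xs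
  have T2: "expectation (\<lambda>\<omega>. (T (depth_list n \<omega>))\<^sup>2) \<le> K * real n powr (1 + l)" if "1 \<le> n" for n
    unfolding T_def l_def using K[OF that sb, unfolded gm] .
  show ?thesis
    unfolding tendsto_in_prob_def q_def[symmetric]
  proof (intro allI impI)
    fix \<epsilon> :: real assume \<epsilon>: "0 < \<epsilon>"
    let ?A = "\<lambda>n. {\<omega> \<in> space M. \<bar>real (root_degree V Z n \<omega>) / real n - (1 - q)\<bar> > \<epsilon>}"
    \<comment> \<open>there are \<open>n + 1\<close> vertices but the degree is divided by \<open>n\<close>; the resulting error \<open>1 - q\<close>
      is at most half of \<open>\<epsilon> n\<close> for these \<open>n\<close>\<close>
    have bound: "measure M (?A n) \<le> K * real n powr (1 + l) / (\<epsilon> * real n / 2)\<^sup>2"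
      if n: "1 \<le> n" "2 / \<epsilon> \<le> real n" for n
    proof (cases "?A n \<in> sets M")
      case True
      let ?B = "{\<omega> \<in> space M. (\<epsilon> * real n / 2)\<^sup>2 \<le> (T (depth_list n \<omega>))\<^sup>2}"
      have mT: "(\<lambda>\<omega>. (T (depth_list n \<omega>))\<^sup>2) \<in> borel_measurable M"
        using integrable_depth_list[of "\<lambda>xs. (T xs)\<^sup>2" n] by simp
      have "measure M (?A n) \<le> measure M ?B"
      proof (rule finite_measure_mono_AE)
        show "AE \<omega> in M. \<omega> \<in> ?A n \<longrightarrow> \<omega> \<in> ?B"
          using root_degree_eq
        proof eventually_elim
          case (elim \<omega>)
          have T_eq: "T xs = depth_sum (indicator {1}) xs - (1 - q) * real (length xs)" for xs
            unfolding T_def diff_conv_add_uminus depth_sum_add depth_sum_const by (simp add: algebra_simps)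
          have T: "T (depth_list n \<omega>) = real (root_degree V Z n \<omega>) - (1 - q) * real n - (1 - q)"
            using elim n T_eq[of "depth_list n \<omega>"] by (simp add: algebra_simps)
          show ?case
          proof
            assume "\<omega> \<in> ?A n"
            then have \<omega>: "\<omega> \<in> space M"
              and "\<epsilon> < \<bar>real (root_degree V Z n \<omega>) / real n - (1 - q)\<bar>" by auto
            note this(2)
            also have "real (root_degree V Z n \<omega>) / real n - (1 - q)
                = (real (root_degree V Z n \<omega>) - (1 - q) * real n) / real n"
              using n by (simp add: field_simps)
            also have "\<bar>\<dots>\<bar> = \<bar>real (root_degree V Z n \<omega>) - (1 - q) * real n\<bar> / real n" by simp
            finally have "\<epsilon> * real n < \<bar>real (root_degree V Z n \<omega>) - (1 - q) * real n\<bar>"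
              using n by (simp add: pos_less_divide_eq)
            moreover have "\<epsilon> * real n / 2 \<ge> 1" using n \<epsilon> by (simp add: field_simps)
            ultimately have "\<epsilon> * real n / 2 \<le> \<bar>T (depth_list n \<omega>)\<bar>" using qs(1,2) unfolding T by linarith
            then have "(\<epsilon> * real n / 2)\<^sup>2 \<le> \<bar>T (depth_list n \<omega>)\<bar>\<^sup>2"
              using \<epsilon> by (intro power_mono) auto
            then show "\<omega> \<in> ?B" using \<omega> by simp
          qed
        qed
        show "?B \<in> sets M" using mT by measurable
      qed
      also have "\<dots> \<le> expectation (\<lambda>\<omega>. (T (depth_list n \<omega>))\<^sup>2) / (\<epsilon> * real n / 2)\<^sup>2"
        using n \<epsilon> integrable_depth_list[of "\<lambda>xs. (T xs)\<^sup>2" n] by (intro integral_Markov_inequality_measure[where A = "{}"]) auto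
      also have "\<dots> \<le> K * real n powr (1 + l) / (\<epsilon> * real n / 2)\<^sup>2"
        using T2 n by (intro divide_right_mono) auto
      finally show ?thesis .
    next
      case False
      have "0 \<le> expectation (\<lambda>\<omega>. (T (depth_list n \<omega>))\<^sup>2)" by simp
      then have "0 \<le> K * real n powr (1 + l)" using T2[OF n(1)] by linarith
      then show ?thesis using measure_notin_sets[OF False] by simp
    qed
    have "(\<lambda>n. 4 * K / \<epsilon>\<^sup>2 * real n powr (l - 1)) \<longlonglongrightarrow> 4 * K / \<epsilon>\<^sup>2 * 0"
      using l by (intro tendsto_mult tendsto_const tendsto_neg_powr filterlim_real_sequentially) auto
    then have lim: "(\<lambda>n. 4 * K / \<epsilon>\<^sup>2 * real n powr (l - 1)) \<longlonglongrightarrow> 0" by simp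
    have rate: "K * real n powr (1 + l) / (\<epsilon> * real n / 2)\<^sup>2 = 4 * K / \<epsilon>\<^sup>2 * real n powr (l - 1)"
      if "1 \<le> n" for n
    proof -
      have "real n powr (1 + l) = real n powr (l - 1) * real n powr 2"
        by (subst powr_add[symmetric]) (simp add: add.commute)
      also have "real n powr 2 = (real n)\<^sup>2" using that by simp
      finally have "real n powr (1 + l) = real n powr (l - 1) * (real n)\<^sup>2" .
      then show ?thesis using that \<epsilon> by (simp add: power2_eq_square field_simps)
    qed
    show "(\<lambda>n. measure M (?A n)) \<longlonglongrightarrow> 0"
    proof (rule tendsto_sandwich[OF _ _ tendsto_const lim])
      show "\<forall>\<^sub>F n in sequentially. measure M (?A n) \<le> 4 * K / \<epsilon>\<^sup>2 * real n powr (l - 1)"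
        using eventually_ge_at_top[of "max 1 (nat \<lceil>2 / \<epsilon>\<rceil>)"]
      proof eventually_elim
        case (elim n)
        then have "1 \<le> n" "2 / \<epsilon> \<le> real n" by linarith+
        then show ?case using bound[of n] rate[of n] by simp
      qed
    qed simp
  qed
qed

end

section \<open>The growth exponent as a minimum\<close>

text \<open>
  The series with these coefficients is \<open>s f'(s) - f(s) + p_0\<close>. Separating the single negative
  coefficient \<open>-p_0\<close> leaves a power series with nonnegative coefficients, so the equation
  \<open>s f'(s) = f(s)\<close> becomes \<open>excess p s = p_0\<close> with an increasing left side.
\<close>

definition excess_coeff :: "nat pmf \<Rightarrow> nat \<Rightarrow> real" where
  "excess_coeff p k = (if k = 0 then 0 else (real k - 1) * pmf p k)"

definition excess :: "nat pmf \<Rightarrow> real \<Rightarrow> real" where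
  "excess p s = (\<Sum>k. excess_coeff p k * s ^ k)"

abbreviation excess_summable :: "nat pmf \<Rightarrow> real \<Rightarrow> bool" where
  "excess_summable p s \<equiv> summable (\<lambda>k. excess_coeff p k * s ^ k)"

lemma excess_coeff_nonneg: "0 \<le> excess_coeff p k"
  by (simp add: excess_coeff_def)

lemma excess_0: "excess p 0 = 0"
  by (simp add: excess_def excess_coeff_def)

text \<open>
  An atom at two or more makes the excess defined above strictly increasing, and it lets depths
  decrease.
\<close>

lemma pmf_large_atom:
  fixes p :: "nat pmf"
  assumes "pmf p 0 + pmf p 1 < 1"
  obtains j where "2 \<le> j" "0 < pmf p j"
proof -
  have "\<exists>j\<ge>2. 0 < pmf p j"
  proof (rule ccontr)
    assume "\<not> (\<exists>j\<ge>2. 0 < pmf p j)"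
    then have "\<not> 0 < pmf p k" if "2 \<le> k" for k using that by blast
    from this pmf_nonneg[of p] have z: "pmf p k = 0" if "2 \<le> k" for k
      using that by (metis order_less_le)
    have "pmf p sums (\<Sum>k\<in>{0, 1}. pmf p k)"
    proof (rule sums_finite)
      fix k :: nat assume "k \<notin> {0, 1}"
      then have "2 \<le> k" by (cases k) auto
      then show "pmf p k = 0" by (rule z)
    qed simp
    then have "(\<Sum>k\<in>{0, 1}. pmf p k) = 1" using pmf_sums_1[of p] by (rule sums_unique2)
    then show False using assms by simp
  qed
  then show ?thesis using that by blast
qed

lemma excess_summable_imp:
  assumes "excess_summable p s" "0 \<le> s"
  shows "summable (\<lambda>k. real k * pmf p k * s ^ k)" "pgf_summable p s"
    and "(\<Sum>k. real k * pmf p k * s ^ k) = excess p s + pgf p s - pmf p 0"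
proof -
  show 1: "summable (\<lambda>k. real k * pmf p k * s ^ k)"
  proof (rule summable_comparison_test_ev[OF _ summable_mult[OF assms(1), of 2]])
    show "\<forall>\<^sub>F k in sequentially. norm (real k * pmf p k * s ^ k) \<le> 2 * (excess_coeff p k * s ^ k)"
      using eventually_ge_at_top[of 2]
    proof eventually_elim
      case (elim k)
      have "real k * pmf p k * s ^ k \<le> (2 * (real k - 1)) * pmf p k * s ^ k"
        using elim assms(2) by (intro mult_right_mono) auto
      moreover have "2 * (excess_coeff p k * s ^ k) = (2 * (real k - 1)) * pmf p k * s ^ k"
        using elim by (simp add: excess_coeff_def)
      moreover have "norm (real k * pmf p k * s ^ k) = real k * pmf p k * s ^ k"
        using assms(2) by (simp add: abs_mult)
      ultimately show ?case by linarith
    qed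
  qed
  show 2: "pgf_summable p s"
  proof (rule summable_comparison_test_ev[OF _ 1])
    show "\<forall>\<^sub>F k in sequentially. norm (pmf p k * s ^ k) \<le> real k * pmf p k * s ^ k"
      using eventually_ge_at_top[of 1]
    proof eventually_elim
      case (elim k)
      have "1 * pmf p k * s ^ k \<le> real k * pmf p k * s ^ k"
        using elim assms(2) by (intro mult_right_mono) auto
      then show ?case using assms(2) by (simp add: abs_mult)
    qed
  qed
  have "(\<lambda>k. excess_coeff p k * s ^ k + pmf p k * s ^ k - (if k = 0 then pmf p 0 else 0))
      sums (excess p s + pgf p s - pmf p 0)"
    unfolding excess_def pgf_def
    using assms 2 by (intro sums_diff sums_add summable_sums sums_single[of 0 "\<lambda>_. pmf p 0"])
  moreover have "excess_coeff p k * s ^ k + pmf p k * s ^ k - (if k = 0 then pmf p 0 else 0)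
      = real k * pmf p k * s ^ k" for k
    by (simp add: excess_coeff_def algebra_simps)
  ultimately show "(\<Sum>k. real k * pmf p k * s ^ k) = excess p s + pgf p s - pmf p 0"
    by (simp add: sums_iff)
qed

text \<open>
  Each monomial lies above its tangent at \<open>s0\<close> (Bernoulli's inequality); the sum of the tangents is
  the left side. This form also covers the radius of convergence, where only a one-sided derivative
  exists.
\<close>

lemma pgf_tangent:
  assumes s0: "0 < s0" "excess_summable p s0" and s: "0 \<le> s" "pgf_summable p s"
  shows "pgf p s0 * (s / s0) + (excess p s0 - pmf p 0) * (s / s0 - 1) \<le> pgf p s"
proof -
  note ex = excess_summable_imp[OF s0(2) less_imp_le[OF s0(1)]]
  define x where "x = s / s0"
  have x: "0 \<le> x" "s = s0 * x" using s0 s by (auto simp: x_def)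
  have "(\<lambda>k. pmf p k * s0 ^ k + (real k * pmf p k * s0 ^ k) * (x - 1))
      sums (pgf p s0 + (excess p s0 + pgf p s0 - pmf p 0) * (x - 1))"
    unfolding ex(3)[symmetric] unfolding pgf_def
    using ex by (intro sums_add sums_mult2 summable_sums)
  moreover have "(\<lambda>k. pmf p k * s ^ k) sums pgf p s"
    unfolding pgf_def using s by (intro summable_sums)
  moreover have "pmf p k * s0 ^ k + (real k * pmf p k * s0 ^ k) * (x - 1) \<le> pmf p k * s ^ k" for k
  proof -
    have "1 + real k * (x - 1) \<le> (1 + (x - 1)) ^ k"
      using x(1) by (intro Bernoulli_inequality) auto
    then have "(pmf p k * s0 ^ k) * (1 + real k * (x - 1)) \<le> (pmf p k * s0 ^ k) * x ^ k"
      using s0 by (intro mult_left_mono) auto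
    then show ?thesis by (simp add: x(2) algebra_simps power_mult_distrib)
  qed
  ultimately have "pgf p s0 + (excess p s0 + pgf p s0 - pmf p 0) * (x - 1) \<le> pgf p s"
    by (rule sums_le[rotated])
  then show ?thesis unfolding x_def[symmetric] by (simp add: algebra_simps)
qed

lemma excess_summable_below_radius:
  assumes "0 \<le> s" "ereal s < pgf_radius p"
  shows "excess_summable p s" "s * deriv (pgf p) s = excess p s + pgf p s - pmf p 0"
proof -
  obtain t where t: "ereal s < t" "t < pgf_radius p" using dense[OF assms(2)] by blast
  then obtain t' where t': "t = ereal t'" by (cases t) auto
  have sm: "pgf_summable p t'" and st: "s < t'"
    using t t' assms(1) by (auto intro!: summable_in_conv_radius simp: pgf_radius_def)
  have diffs: "summable (\<lambda>k. diffs (pmf p) k * s ^ k)"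
  proof (rule termdiff_converges[of s t'])
    fix x :: real assume "norm x < t'"
    then show "summable (\<lambda>k. pmf p k * x ^ k)"
      using powser_inside[of "pmf p" t' x] sm by simp
  qed (use st assms in auto)
  have d: "(\<lambda>k. real k * pmf p k * s ^ (k - Suc 0)) sums (\<Sum>k. diffs (pmf p) k * s ^ k)"
    using diffs_equiv[OF diffs] .
  have "(\<lambda>k. real k * pmf p k * s ^ (k - Suc 0) * s) = (\<lambda>k. real k * pmf p k * s ^ k)"
  proof
    fix k show "real k * pmf p k * s ^ (k - Suc 0) * s = real k * pmf p k * s ^ k" by (cases k) auto
  qed
  then have d': "(\<lambda>k. real k * pmf p k * s ^ k) sums ((\<Sum>k. diffs (pmf p) k * s ^ k) * s)"
    using sums_mult2[OF d, of s] by (simp only:)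
  show ex: "excess_summable p s"
  proof (rule summable_comparison_test'[OF sums_summable[OF d'], of 0])
    fix k :: nat
    show "norm (excess_coeff p k * s ^ k) \<le> real k * pmf p k * s ^ k"
      using assms(1) by (auto simp: excess_coeff_def abs_mult intro!: mult_right_mono)
  qed
  have "(pgf p has_field_derivative (\<Sum>k. diffs (pmf p) k * s ^ k)) (at s)"
    unfolding pgf_def[abs_def] using sm st assms(1) by (intro termdiffs_strong[of _ t']) auto
  then have "deriv (pgf p) s = (\<Sum>k. diffs (pmf p) k * s ^ k)" by (rule DERIV_imp_deriv)
  then have "s * deriv (pgf p) s = (\<Sum>k. real k * pmf p k * s ^ k)"
    using d' by (simp add: sums_iff mult.commute)
  then show "s * deriv (pgf p) s = excess p s + pgf p s - pmf p 0"
    using excess_summable_imp(3)[OF ex assms(1)] by simp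
qed

lemma is_s_root_iff:
  "is_s_root p s \<longleftrightarrow> 0 < s \<and> ereal s < pgf_radius p \<and> excess p s = pmf p 0"
  using excess_summable_below_radius(2)[of s p] by (auto simp: is_s_root_def)

lemma excess_strict_mono:
  assumes "pmf p 0 + pmf p 1 < 1" "0 \<le> s" "s < t" "excess_summable p t"
  shows "excess p s < excess p t"
proof -
  obtain j where j: "2 \<le> j" "0 < pmf p j" using pmf_large_atom[OF assms(1)] .
  have le: "excess_coeff p k * s ^ k \<le> excess_coeff p k * t ^ k" for k
    using assms by (intro mult_left_mono power_mono excess_coeff_nonneg) auto
  have s: "excess_summable p s"
    by (rule summable_comparison_test'[OF assms(4), of 0])
       (use le assms in \<open>auto simp: abs_mult excess_coeff_nonneg\<close>)
  have "0 < (\<Sum>k. excess_coeff p k * t ^ k - excess_coeff p k * s ^ k)"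
  proof (rule suminf_pos2[where i = j])
    show "0 < excess_coeff p j * t ^ j - excess_coeff p j * s ^ j"
      using j assms power_strict_mono[of s t j] by (simp add: excess_coeff_def)
  qed (use le assms s in \<open>auto intro: summable_diff\<close>)
  then show ?thesis
    using suminf_diff[OF assms(4) s] by (simp add: excess_def)
qed

lemma pgf_radius_ge_1: "1 \<le> pgf_radius p"
  unfolding pgf_radius_def using conv_radius_geI[of "pmf p" 1] pgf_summable_1[of p]
  by (simp add: one_ereal_def)

lemma pgf_summable_le_radius: "pgf_summable p s \<Longrightarrow> 0 \<le> s \<Longrightarrow> ereal s \<le> pgf_radius p"
  unfolding pgf_radius_def using conv_radius_geI[of "pmf p" s] by simp

text \<open>
  If \<open>s0\<close> is a root, the tangent there passes through the origin. Without a root the excess stays below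
  \<open>p_0\<close> up to the radius of convergence; this forces the radius to be finite and the series to converge
  there, and the tangent at the radius, extended to the left, lies above the line through the origin.
  A root cannot lie below \<open>1\<close>, because mean at most one says that the excess at \<open>1\<close> is at most
  \<open>p_0\<close>; the radius is at least \<open>1\<close> anyway.
\<close>

lemma s_zero_optimal:
  assumes p0: "0 < pmf p 0" and p01: "pmf p 0 + pmf p 1 < 1"
    and int: "integrable (measure_pmf p) real" and E: "measure_pmf.expectation p real \<le> 1"
  obtains s0 where "s_zero p = ereal s0" "1 \<le> s0" "pgf_summable p s0"
    "\<And>s. 0 \<le> s \<Longrightarrow> pgf_summable p s \<Longrightarrow> pgf p s0 * (s / s0) \<le> pgf p s"
proof (cases "\<exists>s. is_s_root p s")
  case True
  then obtain s0 where s0: "is_s_root p s0" by blast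
  have r: "0 < s0" "ereal s0 < pgf_radius p" "excess p s0 = pmf p 0"
    using s0 by (auto simp: is_s_root_iff)
  have unique: "s = s0" if "is_s_root p s" for s
  proof -
    have s: "0 < s" "ereal s < pgf_radius p" "excess p s = pmf p 0"
      using that by (auto simp: is_s_root_iff)
    have "\<not> s < s0" "\<not> s0 < s"
      using excess_strict_mono[OF p01 _ _ excess_summable_below_radius(1), of s s0]
        excess_strict_mono[OF p01 _ _ excess_summable_below_radius(1), of s0 s] r s by auto
    then show ?thesis by simp
  qed
  have sz: "s_zero p = ereal s0"
  proof -
    have ex1: "\<exists>!s. is_s_root p s" using s0 unique by blast
    show ?thesis unfolding s_zero_def if_P[OF ex1] the1_equality[OF ex1 s0] ..
  qed
  have ge1: "1 \<le> s0"
  proof (rule ccontr)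
    assume "\<not> 1 \<le> s0"
    have k: "(\<lambda>k. pmf p k * real k) sums measure_pmf.expectation p real"
      using expectation_nat_pmf(2)[OF int] .
    have ex1: "excess_summable p 1"
    proof (rule summable_comparison_test'[OF sums_summable[OF k], of 0])
      fix k :: nat
      show "norm (excess_coeff p k * 1 ^ k) \<le> pmf p k * real k"
        using mult_right_mono[of "real k - 1" "real k" "pmf p k"]
        by (cases "k = 0") (auto simp: excess_coeff_def abs_mult mult.commute)
    qed
    have "excess p 1 \<le> pmf p 0"
      using excess_summable_imp(3)[OF ex1] k E by (simp add: pgf_1 sums_iff mult.commute)
    moreover have "excess p s0 < excess p 1"
      using excess_strict_mono[OF p01 _ _ ex1, of s0] r \<open>\<not> 1 \<le> s0\<close> by simp
    ultimately show False using r by simp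
  qed
  note ex = excess_summable_below_radius(1)[OF less_imp_le[OF r(1)] r(2)]
  have sm: "pgf_summable p s0" using excess_summable_imp(2)[OF ex] r by simp
  have "pgf p s0 * (s / s0) \<le> pgf p s" if "0 \<le> s" "pgf_summable p s" for s
    using pgf_tangent[OF r(1) ex that] r by simp
  with sz ge1 sm show ?thesis by (rule that)
next
  case False
  then have s_zero: "s_zero p = pgf_radius p" by (auto simp: s_zero_def)
  obtain j where j: "2 \<le> j" "0 < pmf p j" using pmf_large_atom[OF p01] .
  have below: "excess p s < pmf p 0" if s: "0 \<le> s" "ereal s < pgf_radius p" for s
  proof (rule ccontr)
    assume "\<not> excess p s < pmf p 0"
    moreover have "continuous_on {0..s} (excess p)"
      unfolding excess_def[abs_def]
      by (intro powser_continuous_on excess_summable_below_radius s excess_coeff_nonneg)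
    ultimately obtain x where x: "0 \<le> x" "x \<le> s" "excess p x = pmf p 0"
      using IVT'[of "excess p" 0 "pmf p 0" s] s p0 by (auto simp: excess_0)
    then have "0 < x" using p0 by (cases "x = 0") (auto simp: excess_0)
    moreover have "ereal x < pgf_radius p" using x s by (metis ereal_less_eq(3) le_less_trans)
    ultimately show False using False x by (auto simp: is_s_root_iff)
  qed
  \<comment> \<open>finite sums pass to the radius by continuity, which yields convergence there\<close>
  have partial: "(\<Sum>k\<in>F. excess_coeff p k * s ^ k) \<le> pmf p 0"
    if "finite F" "0 \<le> s" "ereal s < pgf_radius p" for F s
  proof -
    have "(\<Sum>k\<in>F. excess_coeff p k * s ^ k) \<le> excess p s"
      unfolding excess_def using that excess_coeff_nonneg
      by (intro sum_le_suminf excess_summable_below_radius) auto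
    then show ?thesis using below[of s] that by simp
  qed
  have "pgf_radius p \<noteq> \<infinity>"
  proof
    assume inf: "pgf_radius p = \<infinity>"
    define s where "s = 1 + pmf p 0 / pmf p j"
    have s: "1 \<le> s" using p0 j by (simp add: s_def)
    have "pmf p 0 < pmf p j * s" using j by (simp add: s_def field_simps)
    also have "\<dots> \<le> pmf p j * s ^ j"
      using s j by (intro mult_left_mono self_le_power) auto
    also have "\<dots> \<le> excess_coeff p j * s ^ j"
      using j s by (auto simp: excess_coeff_def intro!: mult_right_mono)
    also have "\<dots> \<le> pmf p 0" using partial[of "{j}" s] inf s by simp
    finally show False by simp
  qed
  then obtain r where r: "pgf_radius p = ereal r" "1 \<le> r"
    using pgf_radius_ge_1[of p] by (cases "pgf_radius p") (auto simp: one_ereal_def)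
  have part_r: "(\<Sum>k<n. excess_coeff p k * r ^ k) \<le> pmf p 0" for n
  proof (rule tendsto_upperbound)
    have "isCont (\<lambda>s. \<Sum>k<n. excess_coeff p k * s ^ k) r" by (intro continuous_intros)
    then show "((\<lambda>s. \<Sum>k<n. excess_coeff p k * s ^ k) \<longlongrightarrow> (\<Sum>k<n. excess_coeff p k * r ^ k)) (at_left r)"
      by (simp add: isCont_def filterlim_at_split)
    have "\<forall>\<^sub>F s in at_left r. s \<in> {0<..<r}" using r by (intro eventually_at_left_real) simp
    then show "\<forall>\<^sub>F s in at_left r. (\<Sum>k<n. excess_coeff p k * s ^ k) \<le> pmf p 0"
      by eventually_elim (use partial r in auto)
  qed simp
  have ex: "excess_summable p r"
    using part_r r excess_coeff_nonneg by (intro summableI_nonneg_bounded[of _ "pmf p 0"]) auto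
  have ex_le: "excess p r \<le> pmf p 0"
    unfolding excess_def using part_r by (intro suminf_le_const ex)
  have opt: "pgf p r * (s / r) \<le> pgf p s" if "0 \<le> s" "pgf_summable p s" for s
  proof -
    have "s \<le> r" using pgf_summable_le_radius[OF that(2,1)] r by simp
    then have "0 \<le> (excess p r - pmf p 0) * (s / r - 1)"
      using ex_le r by (intro mult_nonpos_nonpos) auto
    then show ?thesis using pgf_tangent[of r p s] ex that r by simp
  qed
  have "pgf_summable p r" using excess_summable_imp(2)[OF ex] r by simp
  from s_zero[unfolded r(1)] r(2) this opt show ?thesis by (rule that)
qed

text \<open>
  By left continuity of the generating function at \<open>s0\<close> the limit defining \<open>R\<close> is the value
  \<open>s0 / f(s0)\<close>.
\<close>

lemma R_const_optimal:
  assumes "0 < pmf p 0" "pmf p 0 + pmf p 1 < 1"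
    and "integrable (measure_pmf p) real" "measure_pmf.expectation p real \<le> 1"
  obtains s0 where "1 \<le> s0" "pgf_summable p s0" "1 / R_const p = pgf p s0 / s0" "0 < 1 / R_const p"
    "\<And>s. 0 < s \<Longrightarrow> pgf_summable p s \<Longrightarrow> 1 / R_const p \<le> pgf p s / s"
proof -
  obtain s0 where s0: "s_zero p = ereal s0" "1 \<le> s0" "pgf_summable p s0"
    and opt: "\<And>s. 0 \<le> s \<Longrightarrow> pgf_summable p s \<Longrightarrow> pgf p s0 * (s / s0) \<le> pgf p s"
    by (rule s_zero_optimal[OF assms]) blast
  have "pmf p 0 * s0 ^ 0 \<le> pgf p s0"
    unfolding pgf_def using s0 sum_le_suminf[of "\<lambda>k. pmf p k * s0 ^ k" "{0}"] by simp
  then have pos: "0 < pgf p s0" using assms(1) by simp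
  have "(pgf p \<longlongrightarrow> pgf p s0) (at s0 within {0..s0})"
    using pgf_continuous_on[OF s0(3)] s0(2) by (auto simp: continuous_on_def)
  then have "(pgf p \<longlongrightarrow> pgf p s0) (at_left s0)"
    using s0(2) by (simp add: at_within_Icc_at_left)
  then have "((\<lambda>s. s / pgf p s) \<longlongrightarrow> s0 / pgf p s0) (at_left s0)"
    using pos by (intro tendsto_divide tendsto_ident_at) auto
  then have "(((\<lambda>s. s / pgf p s) \<circ> real_of_ereal) \<longlongrightarrow> s0 / pgf p s0) (at_left (ereal s0))"
    by (simp add: at_left_ereal filterlim_filtermap)
  moreover have "\<not> trivial_limit (at_left (ereal s0))"
    by (simp add: at_left_ereal filtermap_bot_iff)
  ultimately have "R_const p = s0 / pgf p s0"
    unfolding R_const_def s0(1) by (intro tendsto_Lim) (simp_all add: comp_def)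
  then have R: "1 / R_const p = pgf p s0 / s0" by simp
  show ?thesis
  proof (rule that[OF s0(2,3) R])
    show "0 < 1 / R_const p" using R pos s0(2) by simp
    show "1 / R_const p \<le> pgf p s / s" if "0 < s" "pgf_summable p s" for s
      unfolding R using opt[of s] that s0(2) by (simp add: field_simps)
  qed
qed

section \<open>Upper bound for the root degree\<close>

context backward_step_model
begin

text \<open>
  The function \<open>k \<mapsto> s0^(-k)\<close> is an eigenfunction of the walk without reflection, and reflection can
  only decrease it because \<open>s0 \<ge> 1\<close>. Hence the expected root degree is \<open>O(n^\<rho>)\<close>, and along \<open>2^m\<close>
  the extra factor \<open>m^(1 + \<delta>)\<close> makes the normalised expectations summable.
\<close>

lemma root_count_AE_upper:
  assumes s0: "1 \<le> s0" "pgf_summable p s0" and \<rho>: "\<rho> = pgf p s0 / s0" and \<delta>: "0 < \<delta>"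
  shows "AE \<omega> in M. (\<lambda>n. depth_sum (indicator {1}) (depth_list n \<omega>) / (real n powr \<rho> * ln (real n) powr (1 + \<delta>)))
    \<longlonglongrightarrow> 0"
proof -
  define h where "h k = (1 / s0) ^ k" for k :: nat
  have "0 \<le> pgf p s0" unfolding pgf_def using s0 by (intro suminf_nonneg) auto
  then have \<rho>0: "0 \<le> \<rho>" using s0 by (simp add: \<rho>)
  have eigen: "child_mean p h k \<le> \<rho> * h k" for k
  proof -
    have le: "h (Suc (k - z)) \<le> (1 / s0) ^ Suc k * s0 ^ z" for z
    proof (cases "z \<le> k")
      case True
      then show ?thesis using s0 by (simp add: h_def power_diff power_divide)
    next
      case False
      have "1 / s0 \<le> 1" using s0 by simp
      also have "1 \<le> s0 ^ (z - Suc k)" using s0 by (intro one_le_power) simp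
      also have "\<dots> = (1 / s0) ^ Suc k * s0 ^ z" using s0 False by (simp add: power_diff power_divide)
      finally show ?thesis using False by (simp add: h_def)
    qed
    have int: "integrable (measure_pmf p) (\<lambda>z. s0 ^ z)"
      unfolding expectation_nat_pmf(1) using s0 by simp
    have "child_mean p h k \<le> measure_pmf.expectation p (\<lambda>z. (1 / s0) ^ Suc k * s0 ^ z)"
      unfolding child_mean_def using le int
      by (intro integral_mono integrable_truncated_diff[of p "\<lambda>i. h (Suc i)"] integrable_mult_right) auto
    also have "\<dots> = \<rho> * h k"
      using sums_unique[OF expectation_nat_pmf(2)[OF int]] by (simp add: \<rho> h_def pgf_def)
    finally show ?thesis .
  qed
  have Eh: "expectation (\<lambda>\<omega>. depth_sum h (depth_list n \<omega>)) \<le> 2 * real n powr \<rho>" if "1 \<le> n" for n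
    using that
  proof (induction n rule: nat_induct_at_least)
    case base
    show ?case using s0 by (simp add: depth_list_1 depth_sum_def h_def prob_space)
  next
    case (Suc n)
    let ?e = "expectation (\<lambda>\<omega>. depth_sum h (depth_list n \<omega>))"
    have "expectation (\<lambda>\<omega>. depth_sum (child_mean p h) (depth_list n \<omega>))
        \<le> expectation (\<lambda>\<omega>. depth_sum (\<lambda>k. \<rho> * h k) (depth_list n \<omega>))"
      by (intro integral_mono integrable_depth_list depth_sum_mono eigen)
    then have "expectation (\<lambda>\<omega>. depth_sum h (depth_list (Suc n) \<omega>)) \<le> ?e + \<rho> * ?e / real (Suc n)"
      unfolding expectation_depth_sum_step[OF Suc.hyps]
      by (intro add_left_mono divide_right_mono) (auto simp: depth_sum_cmult)
    also have "\<dots> = ?e * (1 + \<rho> / real (Suc n))" by (simp add: field_simps)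
    also have "\<dots> \<le> 2 * real n powr \<rho> * (1 + \<rho> / real (Suc n))"
      using Suc.IH \<rho>0 by (intro mult_right_mono) auto
    also have "\<dots> \<le> 2 * real (Suc n) powr \<rho>"
      using powr_growth_step[OF \<rho>0 Suc.hyps] by simp
    finally show ?case .
  qed
  have EL: "expectation (\<lambda>\<omega>. depth_sum (indicator {1}) (depth_list n \<omega>)) \<le> 2 * s0 * real n powr \<rho>"
    if "1 \<le> n" for n
  proof -
    have "expectation (\<lambda>\<omega>. depth_sum (indicator {1}) (depth_list n \<omega>)) \<le> expectation (\<lambda>\<omega>. depth_sum (\<lambda>k. s0 * h k) (depth_list n \<omega>))"
      using s0 by (intro integral_mono integrable_depth_list depth_sum_mono) (auto simp: h_def indicator_def)
    also have "\<dots> \<le> s0 * (2 * real n powr \<rho>)"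
      using Eh[OF that] s0 by (simp add: depth_sum_cmult)
    finally show ?thesis by simp
  qed
  define Y where "Y m \<omega> = depth_sum (indicator {1}) (depth_list (2 ^ m) \<omega>) / ((2 ^ m) powr \<rho> * real m powr (1 + \<delta>))"
    for m \<omega>
  have EY: "expectation (Y m) \<le> 2 * s0 * real m powr (- 1 - \<delta>)" for m
  proof -
    have "expectation (Y m) = expectation (\<lambda>\<omega>. depth_sum (indicator {1}) (depth_list (2 ^ m) \<omega>)) / ((2 ^ m) powr \<rho> * real m powr (1 + \<delta>))"
      by (simp add: Y_def[abs_def])
    also have "\<dots> \<le> 2 * s0 * real (2 ^ m) powr \<rho> / ((2 ^ m) powr \<rho> * real m powr (1 + \<delta>))"
      by (intro divide_right_mono EL) auto
    also have "\<dots> = 2 * s0 * real m powr (- 1 - \<delta>)"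
      using powr_minus_divide[of "real m" "1 + \<delta>"] by simp
    finally show ?thesis .
  qed
  have Y0: "0 \<le> Y m \<omega>" for m \<omega>
    unfolding Y_def by (intro divide_nonneg_nonneg depth_sum_nonneg) auto
  have "AE \<omega> in M. (\<lambda>m. Y m \<omega>) \<longlonglongrightarrow> 0"
  proof (rule AE_tendsto_0_if_summable_expectation)
    show "integrable M (Y m)" for m
      unfolding Y_def[abs_def] using integrable_depth_list[of "\<lambda>xs. depth_sum (indicator {1}) xs / ((2 ^ m) powr \<rho> * real m powr (1 + \<delta>))"] .
    have "summable (\<lambda>m. 2 * s0 * real m powr (- 1 - \<delta>))"
      using \<delta> by (intro summable_mult) (simp add: summable_real_powr_iff)
    then show "summable (\<lambda>m. expectation (Y m))"
      by (rule summable_comparison_test'[of _ 0]) (use EY Y0 in auto)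
  qed (rule Y0)
  then show ?thesis
  proof eventually_elim
    case (elim \<omega>)
    then show ?case
      unfolding Y_def using \<rho>0 \<delta>
      by (intro dyadic_upper depth_sum_depth_list_mono depth_sum_nonneg) auto
  qed
qed

end

section \<open>Finitely supported subharmonic functions\<close>

text \<open>
  The solution, normalised at \<open>1\<close>, of the eigenvalue equation for the walk that is killed instead of
  reflected at \<open>0\<close>. The equation at \<open>k\<close> is solved for the value at \<open>k + 1\<close>, which enters
  through \<open>p_0 > 0\<close>.
\<close>

fun killed_harmonic :: "nat pmf \<Rightarrow> real \<Rightarrow> nat \<Rightarrow> real" where
  "killed_harmonic p l 0 = 0"
| "killed_harmonic p l (Suc 0) = 1"
| "killed_harmonic p l (Suc (Suc k)) =
     (l * killed_harmonic p l (Suc k)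
       - (\<Sum>z\<in>{1..Suc k}. pmf p z * killed_harmonic p l (Suc (Suc k) - z))) / pmf p 0"

lemma killed_harmonic_eq:
  assumes "0 < pmf p 0" "1 \<le> k"
  shows "(\<Sum>z\<le>k. pmf p z * killed_harmonic p l (Suc k - z)) = l * killed_harmonic p l k"
proof -
  obtain k' where k: "k = Suc k'" using assms(2) by (cases k) auto
  have "{..k} = insert 0 {1..k}" by auto
  then have "(\<Sum>z\<le>k. pmf p z * killed_harmonic p l (Suc k - z))
      = pmf p 0 * killed_harmonic p l (Suc k) + (\<Sum>z\<in>{1..k}. pmf p z * killed_harmonic p l (Suc k - z))"
    by simp
  then show ?thesis using assms(1) unfolding k killed_harmonic.simps by simp
qed

text \<open>
  Suppose all values are positive, and let \<open>X\<close> be the upper limit of \<open>h(k+1)/h(k)\<close>. Dividing the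
  equation at \<open>k\<close> by \<open>h(k)\<close>, the term for \<open>z = 0\<close> is \<open>p_0 h(k+1)/h(k)\<close>, close to \<open>p_0 X\<close> for suitable
  large \<open>k\<close>, while the term for \<open>z \<ge> 1\<close> is at least about \<open>p_z X^(1 - z)\<close>. Thus \<open>X f(1/X) \<le> l\<close>, which
  contradicts \<open>l < \<rho>\<close>.
\<close>

lemma killed_harmonic_not_positive:
  assumes p0: "0 < pmf p 0" and p01: "pmf p 0 + pmf p 1 < 1"
    and \<rho>: "\<And>s. 0 < s \<Longrightarrow> pgf_summable p s \<Longrightarrow> \<rho> \<le> pgf p s / s" and l: "l < \<rho>"
  shows "\<exists>k\<ge>1. killed_harmonic p l k \<le> 0"
proof (rule ccontr)
  define h where "h = killed_harmonic p l"
  assume "\<not> (\<exists>k\<ge>1. killed_harmonic p l k \<le> 0)"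
  then have h: "0 < h k" if "1 \<le> k" for k using that unfolding h_def by (meson not_le)
  have h0: "0 \<le> h k" for k using h[of k] by (cases k) (auto simp: h_def less_imp_le)
  have eq: "(\<Sum>z\<le>k. pmf p z * h (Suc k - z)) = l * h k" if "1 \<le> k" for k
    unfolding h_def using killed_harmonic_eq[OF p0 that] .
  define x where "x k = h (Suc k) / h k" for k
  have xpos: "0 < x k" if "1 \<le> k" for k using h[OF that] h[of "Suc k"] by (simp add: x_def)
  have xle: "x k \<le> l / pmf p 0" if "1 \<le> k" for k
  proof -
    have "pmf p 0 * h (Suc k) \<le> (\<Sum>z\<le>k. pmf p z * h (Suc k - z))"
      using member_le_sum[of 0 "{..k}" "\<lambda>z. pmf p z * h (Suc k - z)"] h0 by simp
    then have "pmf p 0 * h (Suc k) \<le> l * h k" using eq[OF that] by simp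
    then have "h (Suc k) \<le> l * h k / pmf p 0" using p0 by (simp add: pos_le_divide_eq mult.commute)
    then show ?thesis using h[OF that] by (simp add: x_def pos_divide_le_eq)
  qed
  \<comment> \<open>\<open>X\<close> is the upper limit of \<open>x\<close>\<close>
  define S where "S = {t. \<forall>\<^sub>F k in sequentially. x k \<le> t}"
  define X where "X = Inf S"
  have S_ne: "l / pmf p 0 \<in> S"
    unfolding S_def using xle by (auto intro: eventually_sequentiallyI[of 1])
  have S_pos: "0 \<le> t" if t: "t \<in> S" for t
  proof -
    obtain N where "\<forall>k\<ge>N. x k \<le> t" using t by (auto simp: S_def eventually_sequentially)
    then obtain k where "x k \<le> t" "1 \<le> k" by (meson nat_le_linear)
    then show ?thesis using xpos[of k] by simp
  qed
  have bdd: "bdd_below S" using S_pos by (rule bdd_belowI)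
  have X0: "0 \<le> X" unfolding X_def using S_ne S_pos by (intro cInf_greatest) auto
  have above: "\<forall>\<^sub>F k in sequentially. x k \<le> t" if t: "X < t" for t
  proof -
    obtain t' where "t' \<in> S" "t' < t" using t cInf_lessD[of S t] S_ne by (auto simp: X_def)
    then have "\<forall>\<^sub>F k in sequentially. x k \<le> t'" by (simp add: S_def)
    then show ?thesis by eventually_elim (use \<open>t' < t\<close> in simp)
  qed
  have below: "\<exists>k\<ge>N. t < x k" if "t < X" for t N
  proof (rule ccontr)
    assume "\<not> (\<exists>k\<ge>N. t < x k)"
    then have "t \<in> S" by (auto simp: S_def eventually_sequentially not_less)
    then have "X \<le> t" unfolding X_def using bdd by (rule cInf_lower)
    then show False using that by simp
  qed
  have key: "pmf p 0 * t' + (\<Sum>z\<in>{1..m}. pmf p z * (1 / t) ^ (z - 1)) \<le> l"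
    if t: "X < t" and t': "t' < X" for t t' m
  proof -
    have tpos: "0 < t" using t X0 by simp
    obtain N where N: "\<And>k. N \<le> k \<Longrightarrow> x k \<le> t" using above[OF t] by (auto simp: eventually_sequentially)
    obtain k where k: "Suc N + m \<le> k" "t' < x k" using below[OF t'] by blast
    have hk: "0 < h k" using k by (intro h) simp
    have ratio: "h k \<le> t ^ i * h (k - i)" if "i \<le> m" for i
      using that
    proof (induction i)
      case (Suc i)
      define n where "n = k - Suc i"
      have n: "k - i = Suc n" "N \<le> n" "1 \<le> n" using Suc.prems k by (auto simp: n_def)
      have "h (Suc n) \<le> t * h n" using N[OF n(2)] h[OF n(3)] by (simp add: x_def pos_divide_le_eq)
      then have "t ^ i * h (Suc n) \<le> t ^ i * (t * h n)" using tpos by (intro mult_left_mono) auto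
      then show ?case using Suc n by (simp add: n_def[symmetric] mult_ac)
    qed simp
    have "pmf p 0 * t' * h k + (\<Sum>z\<in>{1..m}. pmf p z * (1 / t) ^ (z - 1) * h k)
        \<le> pmf p 0 * h (Suc k) + (\<Sum>z\<in>{1..m}. pmf p z * h (Suc k - z))"
    proof (intro add_mono sum_mono)
      have "t' * h k \<le> h (Suc k)" using k(2) hk by (simp add: x_def pos_less_divide_eq)
      then show "pmf p 0 * t' * h k \<le> pmf p 0 * h (Suc k)" by (simp add: mult.assoc mult_left_mono)
      fix z assume z: "z \<in> {1..m}"
      then have "k - (z - 1) = Suc k - z" using k by auto
      then have "h k \<le> t ^ (z - 1) * h (Suc k - z)" using ratio[of "z - 1"] z by auto
      then have "(1 / t) ^ (z - 1) * h k \<le> h (Suc k - z)"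
        using tpos by (simp add: power_divide field_simps)
      then show "pmf p z * (1 / t) ^ (z - 1) * h k \<le> pmf p z * h (Suc k - z)"
        by (simp add: mult.assoc mult_left_mono)
    qed
    also have "\<dots> = (\<Sum>z\<in>insert 0 {1..m}. pmf p z * h (Suc k - z))" by simp
    also have "\<dots> \<le> (\<Sum>z\<le>k. pmf p z * h (Suc k - z))"
      using k h0 by (intro sum_mono2) auto
    also have "\<dots> = l * h k" using k by (intro eq) simp
    finally have "(pmf p 0 * t' + (\<Sum>z\<in>{1..m}. pmf p z * (1 / t) ^ (z - 1))) * h k \<le> l * h k"
      by (simp add: distrib_right sum_distrib_right)
    then show ?thesis using hk by simp
  qed
  \<comment> \<open>an atom \<open>j \<ge> 2\<close> would contribute \<open>p_j X^(1 - j) = \<infinity>\<close> if \<open>X\<close> were \<open>0\<close>; any negative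
    \<open>t'\<close> serves here\<close>
  have Xpos: "0 < X"
  proof (rule ccontr)
    assume "\<not> 0 < X"
    then have X: "X = 0" using X0 by simp
    obtain j where j: "2 \<le> j" "0 < pmf p j" using pmf_large_atom[OF p01] .
    have lpos: "0 < l" using xle[of 1] xpos[of 1] p0 by (smt (verit) divide_nonpos_pos le_refl)
    define t where "t = min 1 (pmf p j / (l + pmf p 0 + 1))"
    have t: "0 < t" "t \<le> 1" using j lpos p0 by (auto simp: t_def)
    have "t \<le> pmf p j / (l + pmf p 0 + 1)" by (simp add: t_def)
    then have "l + pmf p 0 + 1 \<le> pmf p j * (1 / t)" using t lpos p0 by (simp add: field_simps)
    also have "\<dots> \<le> pmf p j * (1 / t) ^ (j - 1)"
      using t j by (intro mult_left_mono self_le_power) auto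
    also have "\<dots> \<le> (\<Sum>z\<in>{1..j}. pmf p z * (1 / t) ^ (z - 1))"
      using j t by (intro member_le_sum[of j "{1..j}" "\<lambda>z. pmf p z * (1 / t) ^ (z - 1)"]) auto
    also have "\<dots> \<le> l + pmf p 0" using key[of t "-1" j] X t by simp
    finally show False by simp
  qed
  define s where "s = 1 / X"
  have s: "0 < s" using Xpos by (simp add: s_def)
  \<comment> \<open>let \<open>t\<close> and \<open>t'\<close> tend to \<open>X\<close>\<close>
  have partial: "(\<Sum>z<Suc m. pmf p z * s ^ z) \<le> l * s" for m
  proof -
    let ?g = "\<lambda>e. pmf p 0 * (X - e) + (\<Sum>z\<in>{1..m}. pmf p z * (1 / (X + e)) ^ (z - 1))"
    have "isCont ?g 0" using Xpos by (intro continuous_intros) auto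
    then have "(?g \<longlongrightarrow> ?g 0) (at_right 0)" by (simp add: isCont_def filterlim_at_split)
    moreover have "\<forall>\<^sub>F e in at_right 0. ?g e \<le> l"
      using eventually_at_right_less[of 0]
      by eventually_elim (use key in auto)
    ultimately have "?g 0 \<le> l" by (intro tendsto_upperbound) auto
    then have "?g 0 * s \<le> l * s" using s by (intro mult_right_mono) auto
    moreover have "?g 0 * s = (\<Sum>z<Suc m. pmf p z * s ^ z)"
    proof -
      have "(\<Sum>z\<in>{1..m}. pmf p z * (1 / X) ^ (z - 1)) * s = (\<Sum>z\<in>{1..m}. pmf p z * s ^ z)"
        unfolding sum_distrib_right
      proof (rule sum.cong[OF refl])
        fix z assume "z \<in> {1..m}"
        then show "pmf p z * (1 / X) ^ (z - 1) * s = pmf p z * s ^ z"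
          by (cases z) (auto simp: s_def)
      qed
      moreover have "{..<Suc m} = insert 0 {1..m}" by auto
      ultimately show ?thesis using Xpos by (simp add: distrib_right) (simp add: s_def)
    qed
    ultimately show ?thesis by simp
  qed
  have partial': "(\<Sum>z<n. pmf p z * s ^ z) \<le> l * s" for n
    using partial[of n] s by (simp add: order_trans[rotated])
  have sm: "pgf_summable p s"
    using partial' s by (intro summableI_nonneg_bounded[of _ "l * s"]) auto
  have "pgf p s \<le> l * s" unfolding pgf_def using partial' by (intro suminf_le_const sm)
  then have "pgf p s / s \<le> l" using s by (simp add: pos_divide_le_eq)
  then show False using \<rho>[OF s sm] l by simp
qed

text \<open>
  Cut the killed harmonic function off just before its first nonpositive value. The cut only replaces
  nonpositive terms by zero, and the reflected walk dominates the killed one on nonnegative functions.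
\<close>

lemma finite_subharmonic_function:
  assumes p0: "0 < pmf p 0" and p01: "pmf p 0 + pmf p 1 < 1"
    and \<rho>: "\<And>s. 0 < s \<Longrightarrow> pgf_summable p s \<Longrightarrow> \<rho> \<le> pgf p s / s" and l: "l < \<rho>"
  obtains K h where "1 \<le> K" "\<And>k. 0 \<le> h k" "h 0 = 0" "h 1 = 1" "\<And>k. K < k \<Longrightarrow> h k = 0"
    "\<And>k. l * h k \<le> child_mean p h k"
proof -
  let ?h = "killed_harmonic p l"
  obtain k where k: "1 \<le> k" "?h k \<le> 0" using killed_harmonic_not_positive[OF p0 p01 \<rho> l] by blast
  define n where "n = (LEAST k. 1 \<le> k \<and> ?h k \<le> 0)"
  have n: "1 \<le> n" "?h n \<le> 0" using LeastI[of "\<lambda>k. 1 \<le> k \<and> ?h k \<le> 0" k] k by (auto simp: n_def)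
  have before: "0 < ?h i" if "1 \<le> i" "i < n" for i
    using not_less_Least[of i "\<lambda>k. 1 \<le> k \<and> ?h k \<le> 0"] that by (auto simp: n_def)
  have "n \<noteq> 1" using n by auto
  then obtain K where K: "n = Suc K" "1 \<le> K" using n by (cases n) auto
  define h where "h k = (if k \<le> K then ?h k else 0)" for k
  have h_nonneg: "0 \<le> h k" for k
    using before[of k] K by (cases "k = 0") (auto simp: h_def less_imp_le)
  \<comment> \<open>the equation at \<open>K\<close> involves the index \<open>K + 1\<close>, where a nonpositive value becomes \<open>0\<close>\<close>
  have h_ge: "?h k \<le> h k" if "k \<le> Suc K" for k
    using that n K by (auto simp: h_def le_Suc_eq)
  have "l * h k \<le> child_mean p h k" for k
  proof (cases "1 \<le> k \<and> k \<le> K")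
    case True
    have "l * h k = (\<Sum>z\<le>k. pmf p z * ?h (Suc k - z))"
      using killed_harmonic_eq[OF p0, of k l] True by (simp add: h_def)
    also have "\<dots> \<le> (\<Sum>z\<le>k. pmf p z * h (Suc k - z))"
      using True by (intro sum_mono mult_left_mono h_ge) auto
    also have "\<dots> = (\<Sum>z\<le>k. h (Suc (k - z)) * pmf p z)"
      by (intro sum.cong refl) (simp add: Suc_diff_le mult.commute)
    also have "\<dots> = (\<Sum>z\<le>k. (if z \<le> k then h (Suc (k - z)) else 0) * pmf p z)"
      by (intro sum.cong) auto
    also have "\<dots> = measure_pmf.expectation p (\<lambda>z. if z \<le> k then h (Suc (k - z)) else 0)"
      by (rule integral_measure_pmf_real[symmetric]) (auto split: if_splits)
    also have "\<dots> \<le> child_mean p h k"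
      unfolding child_mean_def
    proof (rule integral_mono)
      have "(\<lambda>z. if z \<le> k then h (Suc (k - z)) else 0) = (\<lambda>z. indicator {..k} z * h (Suc (k - z)))"
        by (auto simp: indicator_def)
      then show "integrable (measure_pmf p) (\<lambda>z. if z \<le> k then h (Suc (k - z)) else 0)"
        using integrable_real_mult_indicator[of "{..k}" "measure_pmf p" "\<lambda>z. h (Suc (k - z))"]
          integrable_truncated_diff[of p "\<lambda>i. h (Suc i)" k] by (simp add: mult.commute)
    qed (use h_nonneg integrable_truncated_diff[of p "\<lambda>i. h (Suc i)"] in auto)
    finally show ?thesis .
  next
    case False
    then have "h k = 0" by (auto simp: h_def Suc_le_eq not_le)
    then show ?thesis using child_mean_nonneg[of h p k] h_nonneg by simp
  qed
  then show ?thesis using that[of K h] K h_nonneg by (auto simp: h_def)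
qed

section \<open>Functionals that decay along the chain\<close>

text \<open>
  A supermartingale condition on the lists in \<open>A\<close>, with a rate that makes the expectation of \<open>\<Psi>\<close> decay
  like \<open>n\<close> to the power \<open>- \<gamma>\<close>.
\<close>

definition decays :: "nat pmf \<Rightarrow> (nat list \<Rightarrow> bool) \<Rightarrow> real \<Rightarrow> (nat list \<Rightarrow> real) \<Rightarrow> bool" where
  "decays p A \<gamma> \<Psi> \<longleftrightarrow> (\<forall>xs. xs \<noteq> [] \<longrightarrow> A xs \<longrightarrow> avg_next p \<Psi> xs \<le> (1 - \<gamma> / real (length xs)) * \<Psi> xs)"

text \<open>
  From \<open>1/(S + d) = 1/S - d/(S (S + d))\<close> and \<open>d \<le> C\<close>.
\<close>

lemma avg_next_inverse_depth_sum:
  assumes "xs \<noteq> []" "0 < depth_sum g xs" "\<And>k. 0 \<le> g k" "\<And>k. g k \<le> C"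
  shows "avg_next p (\<lambda>ys. 1 / depth_sum g ys) xs \<le> 1 / depth_sum g xs
    - depth_sum (child_mean p g) xs / real (length xs) / (depth_sum g xs * (depth_sum g xs + C))"
proof -
  define S where "S = depth_sum g xs"
  have S: "0 < S" using assms(2) by (simp add: S_def)
  have C: "0 \<le> C" using assms(3,4) order_trans by blast
  have "avg_next p (\<lambda>ys. 1 / depth_sum g ys) xs
      \<le> avg_next p (\<lambda>ys. 1 / S + (- 1 / (S * (S + C))) * g (last ys)) xs"
  proof (rule avg_next_mono)
    fix d
    have "1 / (S + g d) = 1 / S - g d / (S * (S + g d))"
      using S assms(3)[of d] by (simp add: divide_simps add_pos_nonneg)
    moreover have "g d / (S * (S + C)) \<le> g d / (S * (S + g d))"
      using S C assms(3,4)[of d] by (intro divide_left_mono mult_left_mono mult_pos_pos) auto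
    ultimately have "1 / (S + g d) \<le> 1 / S - g d / (S * (S + C))" by linarith
    then show "1 / depth_sum g (xs @ [d]) \<le> 1 / S + (- 1 / (S * (S + C))) * g (last (xs @ [d]))"
      by (simp add: depth_sum_append S_def)
  qed
  also have "\<dots> = 1 / S - depth_sum (child_mean p g) xs / real (length xs) / (S * (S + C))"
    by (simp only: avg_next_add avg_next_cmult avg_next_const[OF assms(1)] avg_next_last) simp
  finally show ?thesis by (simp add: S_def)
qed

lemma decays_cmult: "decays p A \<gamma> \<Psi> \<Longrightarrow> 0 \<le> c \<Longrightarrow> decays p A \<gamma> (\<lambda>xs. c * \<Psi> xs)"
  unfolding decays_def avg_next_cmult
  by (metis mult.left_commute mult_left_mono)

lemma decays_rate_mono:
  assumes "decays p A \<gamma>' \<Psi>" "\<gamma> \<le> \<gamma>'" "\<And>xs. A xs \<Longrightarrow> 0 \<le> \<Psi> xs"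
  shows "decays p A \<gamma> \<Psi>"
  unfolding decays_def
proof (intro allI impI)
  fix xs :: "nat list" assume xs: "xs \<noteq> []" "A xs"
  have "avg_next p \<Psi> xs \<le> (1 - \<gamma>' / real (length xs)) * \<Psi> xs" using assms(1) xs by (simp add: decays_def)
  also have "\<dots> \<le> (1 - \<gamma> / real (length xs)) * \<Psi> xs"
    using assms(2,3) xs by (intro mult_right_mono diff_left_mono divide_right_mono) auto
  finally show "avg_next p \<Psi> xs \<le> (1 - \<gamma> / real (length xs)) * \<Psi> xs" .
qed

text \<open>
  Bounded increments cost the factor \<open>S/(S + C)\<close>, which is close to one only when \<open>S\<close> is large; hence
  the restriction to lists with \<open>S \<ge> B\<close>.
\<close>

lemma decays_inverse_subharmonic:
  assumes h: "\<And>k. 0 \<le> h k" "\<And>k. h k \<le> C" "\<And>k. l * h k \<le> child_mean p h k"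
    and l: "0 \<le> l" and B: "0 < B" and A: "\<And>xs. A xs \<Longrightarrow> B \<le> depth_sum h xs"
  shows "decays p A (l * (B / (B + C))) (\<lambda>xs. 1 / depth_sum h xs)"
  unfolding decays_def
proof (intro allI impI)
  fix xs :: "nat list" assume xs: "xs \<noteq> []" "A xs"
  define S n where "S = depth_sum h xs" and "n = real (length xs)"
  have S: "B \<le> S" "0 < S" using A[OF xs(2)] B by (auto simp: S_def)
  have C: "0 \<le> C" using h(1,2) order_trans by blast
  have n: "0 < n" using xs by (simp add: n_def)
  have "l * S \<le> depth_sum (child_mean p h) xs"
    unfolding S_def depth_sum_cmult[symmetric] by (intro depth_sum_mono h)
  then have "l * S / n / (S * (S + C)) \<le> depth_sum (child_mean p h) xs / n / (S * (S + C))"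
    using n S C by (intro divide_right_mono) auto
  moreover have "l * S / n / (S * (S + C)) = l * (S / (S + C)) / n * (1 / S)"
    using S n by simp
  moreover have "l * (B / (B + C)) / n * (1 / S) \<le> l * (S / (S + C)) / n * (1 / S)"
  proof -
    have "B / (B + C) \<le> S / (S + C)" using S B C
      using mult_right_mono[of B S C] by (simp add: divide_simps add_pos_nonneg) (simp add: algebra_simps)
    then show ?thesis using l n S by (intro mult_right_mono divide_right_mono mult_left_mono) auto
  qed
  moreover have "avg_next p (\<lambda>xs. 1 / depth_sum h xs) xs
      \<le> 1 / S - depth_sum (child_mean p h) xs / n / (S * (S + C))"
    unfolding S_def n_def using xs(1) S(2)[unfolded S_def] h(1,2) by (rule avg_next_inverse_depth_sum)
  ultimately have "avg_next p (\<lambda>xs. 1 / depth_sum h xs) xs \<le> 1 / S - l * (B / (B + C)) / n * (1 / S)"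
    by linarith
  also have "\<dots> = (1 - l * (B / (B + C)) / n) * (1 / S)" by (simp only: left_diff_distrib mult_1_left)
  finally show "avg_next p (\<lambda>xs. 1 / depth_sum h xs) xs
      \<le> (1 - l * (B / (B + C)) / real (length xs)) * (1 / depth_sum h xs)"
    unfolding S_def n_def .
qed

text \<open>
  If \<open>Y\<close>, the sum of \<open>g'\<close>, feeds \<open>X\<close>, the sum of \<open>g\<close>, then a decaying bound for \<open>1/Y\<close> yields one for
  \<open>1/X\<close> at any smaller rate. The functional \<open>1/X\<close> by itself need not decay: it does so at rate about
  \<open>c Y/X\<close>, which is too small when \<open>Y\<close> is small compared with \<open>X\<close>. But then \<open>1/X\<close> is dominated by
  \<open>1/Y\<close>, and the spare rate \<open>\<gamma>' - \<gamma>\<close> of \<open>\<Psi>'\<close> pays for it; the arithmetic-geometric mean inequality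
  shows that the given weight suffices.
\<close>

lemma decays_transfer:
  assumes g: "\<And>k. 0 \<le> g k" "\<And>k. g k \<le> 1" and g': "\<And>k. c * g' k \<le> child_mean p g k" and c: "0 < c"
    and \<gamma>: "0 \<le> \<gamma>" "\<gamma> < \<gamma>'" and \<Psi>': "decays p A \<gamma>' \<Psi>'"
    and A: "\<And>xs. A xs \<Longrightarrow> 1 \<le> depth_sum g xs" "\<And>xs. A xs \<Longrightarrow> 0 < depth_sum g' xs"
      "\<And>xs. A xs \<Longrightarrow> 1 / depth_sum g' xs \<le> \<Psi>' xs"
  shows "decays p A \<gamma> (\<lambda>xs. 1 / depth_sum g xs + \<gamma>\<^sup>2 / (2 * c * (\<gamma>' - \<gamma>)) * \<Psi>' xs)"
  unfolding decays_def
proof (intro allI impI)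
  fix xs :: "nat list" assume xs: "xs \<noteq> []" "A xs"
  define X Y n where "X = depth_sum g xs" and "Y = depth_sum g' xs" and "n = real (length xs)"
  define \<kappa> where "\<kappa> = \<gamma>\<^sup>2 / (2 * c * (\<gamma>' - \<gamma>))"
  define e where "e = \<gamma>\<^sup>2 / (2 * c)"
  have X: "1 \<le> X" and Y: "0 < Y" and \<Psi>Y: "1 / Y \<le> \<Psi>' xs" and n: "0 < n"
    using A[OF xs(2)] xs(1) by (auto simp: X_def Y_def n_def)
  have \<kappa>: "0 \<le> \<kappa>" "\<kappa> * (\<gamma>' - \<gamma>) = e" using c \<gamma> by (auto simp: \<kappa>_def e_def)
  have e: "0 \<le> e" "2 * c * e = \<gamma>\<^sup>2" using c by (auto simp: e_def)
  \<comment> \<open>the discriminant condition \<open>2 c e = \<gamma>\<^sup>2\<close> is what fixes the weight \<open>\<kappa>\<close>\<close>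
  have quad: "\<gamma> / X \<le> c * Y / (X * (X + 1)) + e * \<Psi>' xs"
  proof -
    have "0 \<le> (c * Y - \<gamma> * X)\<^sup>2" by simp
    also have "\<dots> = c * (c * Y\<^sup>2 + 2 * e * X\<^sup>2 - 2 * \<gamma> * X * Y)"
      using e(2) by (simp add: power2_eq_square algebra_simps)
    finally have "0 \<le> c * Y\<^sup>2 + 2 * e * X\<^sup>2 - 2 * \<gamma> * X * Y" using c by (simp add: zero_le_mult_iff)
    then have "0 \<le> (c * Y\<^sup>2 + 2 * e * X\<^sup>2 - 2 * \<gamma> * X * Y) / (2 * X\<^sup>2 * Y)"
      using Y by (intro divide_nonneg_nonneg) auto
    also have "\<dots> = c * Y / (X * (2 * X)) + e / Y - \<gamma> / X"
      using X Y by (simp add: diff_divide_distrib add_divide_distrib power2_eq_square)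
    finally have "\<gamma> / X \<le> c * Y / (X * (2 * X)) + e / Y" by simp
    moreover have "c * Y / (X * (2 * X)) \<le> c * Y / (X * (X + 1))"
      using X Y c by (intro divide_left_mono mult_left_mono mult_pos_pos) auto
    moreover have "e / Y \<le> e * \<Psi>' xs" using mult_left_mono[OF \<Psi>Y e(1)] by simp
    ultimately show ?thesis by linarith
  qed
  have "c * Y \<le> depth_sum (child_mean p g) xs"
    unfolding Y_def depth_sum_cmult[symmetric] by (intro depth_sum_mono g')
  then have "c * Y / n / (X * (X + 1)) \<le> depth_sum (child_mean p g) xs / n / (X * (X + 1))"
    using n X by (intro divide_right_mono) auto
  then have 1: "avg_next p (\<lambda>ys. 1 / depth_sum g ys) xs \<le> 1 / X - c * Y / (X * (X + 1)) / n"
    using avg_next_inverse_depth_sum[of xs g 1 p] xs X g by (simp add: X_def n_def mult.commute)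
  have "avg_next p \<Psi>' xs \<le> (1 - \<gamma>' / n) * \<Psi>' xs" using \<Psi>' xs by (simp add: decays_def n_def)
  from mult_left_mono[OF this \<kappa>(1)]
  have "avg_next p (\<lambda>xs. 1 / depth_sum g xs + \<kappa> * \<Psi>' xs) xs
      \<le> (1 / X - c * Y / (X * (X + 1)) / n) + \<kappa> * ((1 - \<gamma>' / n) * \<Psi>' xs)"
    unfolding avg_next_add avg_next_cmult using 1 by linarith
  also have "\<dots> = 1 / X + \<kappa> * (1 - \<gamma> / n) * \<Psi>' xs
      - (c * Y / (X * (X + 1)) + (\<kappa> * (\<gamma>' - \<gamma>)) * \<Psi>' xs) / n"
    by (simp add: algebra_simps diff_divide_distrib add_divide_distrib)
  also have "\<dots> \<le> 1 / X + \<kappa> * (1 - \<gamma> / n) * \<Psi>' xs - (\<gamma> / X) / n"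
    unfolding \<kappa>(2) using quad n by (intro diff_left_mono divide_right_mono) auto
  also have "\<dots> = (1 - \<gamma> / n) * (1 / X + \<kappa> * \<Psi>' xs)" by (simp add: algebra_simps)
  finally show "avg_next p (\<lambda>xs. 1 / depth_sum g xs + \<kappa> * \<Psi>' xs) xs
      \<le> (1 - \<gamma> / real (length xs)) * (1 / depth_sum g xs + \<kappa> * \<Psi>' xs)"
    by (simp add: X_def n_def)
qed

text \<open>
  A step of size at least two takes every depth in \<open>{1..b+1}\<close> into \<open>{1..b}\<close>. Starting from the support
  \<open>{1..K}\<close> of \<open>h\<close>, repeated transfer therefore reaches depth \<open>1\<close>, with an arbitrarily small loss of
  rate at each of finitely many stages.
\<close>

lemma root_potential:
  assumes p01: "pmf p 0 + pmf p 1 < 1" and K: "1 \<le> K"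
    and h: "\<And>k. 0 \<le> h k" "h 0 = 0" "\<And>k. K < k \<Longrightarrow> h k = 0" "\<And>k. h k \<le> C"
      "\<And>k. l * h k \<le> child_mean p h k"
    and l: "0 \<le> l" and B: "0 < B" and C: "0 < C" and \<gamma>: "0 \<le> \<gamma>" "\<gamma> < l * (B / (B + C))"
    and A: "\<And>xs. A xs \<Longrightarrow> 1 \<le> depth_sum (indicator {1}) xs" "\<And>xs. A xs \<Longrightarrow> B \<le> depth_sum h xs"
  obtains \<Psi> where "decays p A \<gamma> \<Psi>" "\<And>xs. 0 \<le> \<Psi> xs"
    "\<And>xs. A xs \<Longrightarrow> 1 / depth_sum (indicator {1}) xs \<le> \<Psi> xs"
proof -
  let ?g = "\<lambda>b. indicator {1..b} :: nat \<Rightarrow> real"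
  obtain j where j: "2 \<le> j" "0 < pmf p j" using pmf_large_atom[OF p01] .
  have g_ge: "1 \<le> depth_sum (?g b) xs" if "1 \<le> b" "A xs" for b xs
  proof -
    have "depth_sum (indicator {1}) xs \<le> depth_sum (?g b) xs"
      using that(1) by (intro depth_sum_mono) (auto simp: indicator_def)
    then show ?thesis using A(1)[OF that(2)] by linarith
  qed
  have main: "\<forall>\<gamma>. 0 \<le> \<gamma> \<and> \<gamma> < l * (B / (B + C)) \<longrightarrow> (\<exists>\<Psi>. decays p A \<gamma> \<Psi> \<and> (\<forall>xs. 0 \<le> \<Psi> xs) \<and>
      (\<forall>xs. A xs \<longrightarrow> 1 / depth_sum (?g b) xs \<le> \<Psi> xs))" if "b \<le> K" "1 \<le> b" for b
    using that
  proof (induction rule: inc_induct)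
    case base
    show ?case
    proof (intro allI impI)
      fix \<gamma> assume \<gamma>: "0 \<le> \<gamma> \<and> \<gamma> < l * (B / (B + C))"
      let ?\<Psi> = "\<lambda>xs. C * (1 / depth_sum h xs)"
      have nn: "0 \<le> ?\<Psi> xs" for xs using C h(1) by (simp add: depth_sum_nonneg)
      have "decays p A (l * (B / (B + C))) ?\<Psi>"
        using C by (intro decays_cmult decays_inverse_subharmonic h l B A(2)) auto
      then have "decays p A \<gamma> ?\<Psi>" by (rule decays_rate_mono) (use \<gamma> nn in auto)
      moreover have "1 / depth_sum (?g K) xs \<le> ?\<Psi> xs" if "A xs" for xs
      proof -
        have "depth_sum h xs \<le> depth_sum (\<lambda>k. C * ?g K k) xs"
        proof (rule depth_sum_mono)
          fix k show "h k \<le> C * ?g K k"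
            using h(2) h(3)[of k] h(4)[of k] by (cases "k = 0"; cases "K < k") (auto simp: indicator_def)
        qed
        then have "depth_sum h xs \<le> C * depth_sum (?g K) xs" by (simp add: depth_sum_cmult)
        moreover have "0 < depth_sum h xs" using A(2)[OF that] B by linarith
        moreover have "0 < depth_sum (?g K) xs" using g_ge[OF K that] by linarith
        ultimately show ?thesis by (simp add: divide_simps mult.commute)
      qed
      ultimately show "\<exists>\<Psi>. decays p A \<gamma> \<Psi> \<and> (\<forall>xs. 0 \<le> \<Psi> xs) \<and>
          (\<forall>xs. A xs \<longrightarrow> 1 / depth_sum (?g K) xs \<le> \<Psi> xs)"
        using nn by (intro exI[of _ ?\<Psi>]) blast
    qed
  next
    case (step b)
    note b = step.prems
    show ?case
    proof (intro allI impI)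
      fix \<gamma> assume \<gamma>: "0 \<le> \<gamma> \<and> \<gamma> < l * (B / (B + C))"
      then obtain \<gamma>' where \<gamma>': "\<gamma> < \<gamma>'" "\<gamma>' < l * (B / (B + C))" using dense by blast
      then obtain \<Psi>' where \<Psi>': "decays p A \<gamma>' \<Psi>'" "\<And>xs. 0 \<le> \<Psi>' xs"
        "\<And>xs. A xs \<Longrightarrow> 1 / depth_sum (?g (Suc b)) xs \<le> \<Psi>' xs"
        using step.IH \<gamma> by (meson le_SucI b less_imp_le order_trans)
      let ?\<Psi> = "\<lambda>xs. 1 / depth_sum (?g b) xs + \<gamma>\<^sup>2 / (2 * pmf p j * (\<gamma>' - \<gamma>)) * \<Psi>' xs"
      have down: "pmf p j * ?g (Suc b) k \<le> child_mean p (?g b) k" for k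
      proof (cases "1 \<le> k \<and> k \<le> Suc b")
        case True
        have "pmf p j = measure_pmf.expectation p (indicator {j})"
          by (simp add: measure_pmf_single)
        also have "\<dots> \<le> measure_pmf.expectation p (\<lambda>z. ?g b (Suc (k - z)))"
        proof (rule integral_mono)
          show "integrable (measure_pmf p) (indicator {j} :: nat \<Rightarrow> real)"
            by (rule measure_pmf.integrable_const_bound[where B = 1]) auto
          show "integrable (measure_pmf p) (\<lambda>z. ?g b (Suc (k - z)))"
            by (rule integrable_truncated_diff[of p "\<lambda>i. ?g b (Suc i)"])
          show "indicator {j} z \<le> ?g b (Suc (k - z))" for z
            using True j b by (auto simp: indicator_def)
        qed
        finally show ?thesis using True by (simp add: child_mean_def)
      next
        case False
        then have "?g (Suc b) k = 0" by (auto simp: indicator_def)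
        then show ?thesis using child_mean_nonneg[of "?g b" p k] by simp
      qed
      have "decays p A \<gamma> ?\<Psi>"
      proof (rule decays_transfer[where g' = "?g (Suc b)"])
        show "0 < depth_sum (?g (Suc b)) xs" if "A xs" for xs
          using g_ge[of "Suc b" xs] that by simp
      qed (use down j \<gamma> \<gamma>' \<Psi>' g_ge b in \<open>auto simp: indicator_def\<close>)
      moreover have nn: "0 \<le> ?\<Psi> xs" for xs
        using j \<gamma>' \<Psi>'(2)[of xs] depth_sum_nonneg[of "?g b" xs]
        by (intro add_nonneg_nonneg mult_nonneg_nonneg divide_nonneg_nonneg) auto
      moreover have "1 / depth_sum (?g b) xs \<le> ?\<Psi> xs" for xs
        using j \<gamma>' \<Psi>'(2)[of xs] by simp
      ultimately show "\<exists>\<Psi>. decays p A \<gamma> \<Psi> \<and> (\<forall>xs. 0 \<le> \<Psi> xs) \<and>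
          (\<forall>xs. A xs \<longrightarrow> 1 / depth_sum (?g b) xs \<le> \<Psi> xs)"
        by (intro exI[of _ ?\<Psi>]) blast
    qed
  qed
  show ?thesis using main[OF K order_refl] \<gamma> that by auto
qed

section \<open>Lower bound for the root degree\<close>

context backward_step_model
begin

text \<open>
  The expectation of \<open>\<Psi>\<close> on the event \<open>A\<close> at time \<open>k\<close> decays like \<open>n\<close> to the power \<open>- \<gamma>\<close>, so it stays
  summable along \<open>2^m\<close> after multiplication by \<open>(2^m)^a\<close>.
\<close>

lemma AE_decay:
  assumes dec: "decays p A \<gamma> \<Psi>" and nn: "\<And>xs. 0 \<le> \<Psi> xs"
    and up: "\<And>xs ys. A xs \<Longrightarrow> A (xs @ ys)" and \<gamma>: "0 \<le> \<gamma>" and a: "a < \<gamma>" and k: "1 \<le> k"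
  shows "AE \<omega> in M. A (depth_list k \<omega>) \<longrightarrow> (\<lambda>m. (2 ^ m) powr a * \<Psi> (depth_list (2 ^ m) \<omega>)) \<longlonglongrightarrow> 0"
proof -
  \<comment> \<open>the event at time \<open>k\<close> is read off from the first \<open>k + 1\<close> entries of any later list\<close>
  define \<Phi> where "\<Phi> xs = of_bool (A (take (Suc k) xs)) * \<Psi> xs" for xs
  have \<Phi>0: "0 \<le> \<Phi> xs" for xs using nn by (simp add: \<Phi>_def)
  define e where "e n = expectation (\<lambda>\<omega>. \<Phi> (depth_list n \<omega>))" for n
  have e0: "0 \<le> e n" for n unfolding e_def using \<Phi>0 by simp
  have step: "e (Suc n) \<le> (real (Suc n) / real (Suc (Suc n))) powr \<gamma> * e n" if n: "k \<le> n" for n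
  proof -
    have n1: "1 \<le> n" using n k by simp
    have "avg_next p \<Phi> (depth_list n \<omega>) \<le> (1 - \<gamma> / real (Suc n)) * \<Phi> (depth_list n \<omega>)" for \<omega>
    proof -
      have "avg_next p \<Phi> (depth_list n \<omega>) = of_bool (A (take (Suc k) (depth_list n \<omega>))) * avg_next p \<Psi> (depth_list n \<omega>)"
        unfolding avg_next_cmult[symmetric] using n by (intro avg_next_cong) (simp add: \<Phi>_def)
      moreover have "A (depth_list n \<omega>)" if "A (take (Suc k) (depth_list n \<omega>))"
        using up[OF that, of "drop (Suc k) (depth_list n \<omega>)"] by simp
      ultimately show ?thesis
        using dec[unfolded decays_def, rule_format, of "depth_list n \<omega>"] by (auto simp: \<Phi>_def)
    qed
    then have "e (Suc n) \<le> expectation (\<lambda>\<omega>. (1 - \<gamma> / real (Suc n)) * \<Phi> (depth_list n \<omega>))"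
      unfolding e_def expectation_step[OF n1]
      by (intro integral_mono integrable_depth_list integrable_mult_right)
    also have "\<dots> = (1 - \<gamma> / real (Suc n)) * e n" by (simp add: e_def)
    also have "\<dots> \<le> (real (Suc n) / real (Suc (Suc n))) powr \<gamma> * e n"
      using e0 by (intro mult_right_mono powr_decay_step \<gamma>)
    finally show ?thesis .
  qed
  have e_le: "e n \<le> (real (Suc k) / real (Suc n)) powr \<gamma> * e k" if "k \<le> n" for n
    using that
  proof (induction n rule: dec_induct)
    case (step n)
    have "e (Suc n) \<le> (real (Suc n) / real (Suc (Suc n))) powr \<gamma> * ((real (Suc k) / real (Suc n)) powr \<gamma> * e k)"
      using order_trans[OF \<open>k \<le> n \<Longrightarrow> e (Suc n) \<le> _\<close> mult_left_mono[OF step.IH]] step.hyps by simp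
    also have "\<dots> = (real (Suc k) / real (Suc (Suc n))) powr \<gamma> * e k"
      by (simp add: powr_divide)
    finally show ?case .
  qed simp
  define Y where "Y m \<omega> = (2 ^ m) powr a * \<Phi> (depth_list (2 ^ m) \<omega>)" for m \<omega>
  define c where "c = real (Suc k) powr \<gamma> * e k"
  have EY: "expectation (Y m) \<le> c * (2 powr (a - \<gamma>)) ^ m" if m: "k \<le> m" for m
  proof -
    have "k \<le> 2 ^ m" using m less_exp[of m] by linarith
    from e_le[OF this] have "e (2 ^ m) \<le> (real (Suc k) / real (Suc (2 ^ m))) powr \<gamma> * e k" .
    also have "\<dots> \<le> (real (Suc k) / 2 ^ m) powr \<gamma> * e k"
      using e0 \<gamma> by (intro mult_right_mono powr_mono2 divide_left_mono mult_pos_pos) (auto simp: add_pos_pos)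
    also have "\<dots> = c / (2 ^ m) powr \<gamma>" by (simp add: c_def powr_divide)
    finally have "(2 ^ m) powr a * e (2 ^ m) \<le> (2 ^ m) powr a * (c / (2 ^ m) powr \<gamma>)"
      by (rule mult_left_mono) simp
    also have "\<dots> = c * ((2 ^ m) powr (a - \<gamma>))" by (simp add: powr_diff)
    also have "(2 ^ m :: real) powr (a - \<gamma>) = (2 powr (a - \<gamma>)) ^ m"
      by (simp add: powr_power powr_powr mult.commute flip: powr_realpow)
    finally show ?thesis by (simp add: Y_def[abs_def] e_def)
  qed
  have Y0: "0 \<le> Y m \<omega>" for m \<omega> using \<Phi>0 by (simp add: Y_def)
  have "AE \<omega> in M. (\<lambda>m. Y m \<omega>) \<longlonglongrightarrow> 0"
  proof (rule AE_tendsto_0_if_summable_expectation)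
    show "integrable M (Y m)" for m
      unfolding Y_def[abs_def] by (intro integrable_mult_right integrable_depth_list)
    have "2 powr (a - \<gamma>) < (1::real)" using a powr_less_mono[of "a - \<gamma>" 0 2] by simp
    then have "summable (\<lambda>m. c * (2 powr (a - \<gamma>)) ^ m)"
      by (intro summable_mult summable_geometric) simp
    then show "summable (\<lambda>m. expectation (Y m))"
      by (rule summable_comparison_test'[of _ k]) (use EY Y0 in auto)
  qed (rule Y0)
  then show ?thesis
  proof eventually_elim
    case (elim \<omega>)
    show ?case
    proof
      assume Ak: "A (depth_list k \<omega>)"
      show "(\<lambda>m. (2 ^ m) powr a * \<Psi> (depth_list (2 ^ m) \<omega>)) \<longlonglongrightarrow> 0"
      proof (rule Lim_transform_eventually[OF elim])
        show "\<forall>\<^sub>F m in sequentially. Y m \<omega> = (2 ^ m) powr a * \<Psi> (depth_list (2 ^ m) \<omega>)"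
          using eventually_ge_at_top[of k]
        proof eventually_elim
          case (elim m)
          then have "k \<le> 2 ^ m" using less_exp[of m] by linarith
          then show ?case using Ak by (simp add: Y_def \<Phi>_def take_depth_list del: take_Suc)
        qed
      qed
    qed
  qed
qed

text \<open>
  The decay is used twice. With threshold \<open>1\<close>, which always holds, it gives a small but positive growth
  exponent, so \<open>S_n(h)\<close> tends to infinity and the threshold \<open>B\<close> is passed almost surely at
  some time. From that time on the functional of \<open>root_potential\<close> decays at a rate above \<open>a\<close>.
\<close>

lemma root_count_AE_lower:
  assumes p0: "0 < pmf p 0" and p01: "pmf p 0 + pmf p 1 < 1"
    and \<rho>: "\<And>s. 0 < s \<Longrightarrow> pgf_summable p s \<Longrightarrow> \<rho> \<le> pgf p s / s" and a: "0 \<le> a" "a < \<rho>"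
  shows "AE \<omega> in M. filterlim (\<lambda>n. depth_sum (indicator {1}) (depth_list n \<omega>) / real n powr a) at_top sequentially"
proof -
  obtain l where l: "a < l" "l < \<rho>" using dense[OF a(2)] by blast
  have l0: "0 < l" using a l by simp
  obtain K h where K: "1 \<le> K" and h: "\<And>k. 0 \<le> h k" "h 0 = 0" "h 1 = 1" "\<And>k. K < k \<Longrightarrow> h k = 0"
      "\<And>k. l * h k \<le> child_mean p h k"
    using finite_subharmonic_function[OF p0 p01 \<rho> l(2)] by blast
  define C where "C = (\<Sum>k\<le>K. h k)"
  have hC: "h k \<le> C" for k
  proof (cases "k \<le> K")
    case True
    then show ?thesis unfolding C_def using h(1) by (intro member_le_sum) auto
  next
    case False
    then show ?thesis using h(1,4) by (simp add: C_def sum_nonneg)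
  qed
  have C: "1 \<le> C" using hC[of 1] h(3) by simp
  have S1: "1 \<le> depth_sum h (depth_list n \<omega>)" if "1 \<le> n" for n \<omega>
    using depth_sum_depth_list_mono[of h "Suc 0" n \<omega>] h that by (simp add: depth_list_1) (simp add: depth_sum_def)
  have S_mono: "depth_sum h (depth_list m \<omega>) \<le> depth_sum h (depth_list n \<omega>)" if "m \<le> n" for m n \<omega>
    using h(1) that by (rule depth_sum_depth_list_mono)
  have grow: "AE \<omega> in M. filterlim (\<lambda>n. depth_sum h (depth_list n \<omega>)) at_top sequentially"
  proof -
    define \<gamma> where "\<gamma> = l * (1 / (1 + C))"
    have \<gamma>: "0 < \<gamma>" using l0 C by (simp add: \<gamma>_def)
    have "decays p (\<lambda>xs. 1 \<le> depth_sum h xs) \<gamma> (\<lambda>xs. 1 / depth_sum h xs)"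
      unfolding \<gamma>_def using l0 by (intro decays_inverse_subharmonic h hC) auto
    then have "AE \<omega> in M. 1 \<le> depth_sum h (depth_list 1 \<omega>) \<longrightarrow>
        (\<lambda>m. (2 ^ m) powr (\<gamma> / 2) * (1 / depth_sum h (depth_list (2 ^ m) \<omega>))) \<longlonglongrightarrow> 0"
      using \<gamma> h(1) by (intro AE_decay) (auto simp: depth_sum_nonneg depth_sum_append add_increasing2)
    then show ?thesis
    proof eventually_elim
      case (elim \<omega>)
      then have "(\<lambda>m. (2 ^ m) powr (\<gamma> / 2) / depth_sum h (depth_list (2 ^ m) \<omega>)) \<longlonglongrightarrow> 0" using S1[of 1] by simp
      then have "filterlim (\<lambda>n. depth_sum h (depth_list n \<omega>) / real n powr (\<gamma> / 2)) at_top sequentially"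
        using \<gamma> S_mono by (intro dyadic_growth) (auto intro: less_le_trans[OF zero_less_one S1])
      then show ?case
      proof (rule filterlim_at_top_mono)
        show "\<forall>\<^sub>F n in sequentially. depth_sum h (depth_list n \<omega>) / real n powr (\<gamma> / 2) \<le> depth_sum h (depth_list n \<omega>)"
          using eventually_ge_at_top[of 1]
        proof eventually_elim
          case (elim n)
          have "1 \<le> real n powr (\<gamma> / 2)" using elim \<gamma> by (intro ge_one_powr_ge_zero) auto
          then show ?case using S1[OF elim, of \<omega>] elim by (simp add: divide_le_eq mult_le_cancel_left1)
        qed
      qed
    qed
  qed
  \<comment> \<open>large enough that the rate \<open>l B / (B + C)\<close> exceeds \<open>a\<close>\<close>
  define B where "B = (a * C + 1) / (l - a)"
  have "0 \<le> a * C" using a C by simp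
  then have B: "0 < B" using l by (simp add: B_def)
  have "B * (l - a) = a * C + 1" using l by (simp add: B_def)
  then have "a * (B + C) < l * B" by (simp add: algebra_simps)
  then have "a < l * (B / (B + C))" using B C by (simp add: pos_less_divide_eq)
  then obtain \<gamma> where \<gamma>: "a < \<gamma>" "\<gamma> < l * (B / (B + C))" using dense by blast
  define A where "A xs \<longleftrightarrow> 1 \<le> depth_sum (indicator {1}) xs \<and> B \<le> depth_sum h xs" for xs
  obtain \<Psi> where \<Psi>: "decays p A \<gamma> \<Psi>" "\<And>xs. 0 \<le> \<Psi> xs"
      "\<And>xs. A xs \<Longrightarrow> 1 / depth_sum (indicator {1}) xs \<le> \<Psi> xs"
  proof (rule root_potential[of p K h C l B \<gamma> A])
    show "0 < C" "0 \<le> \<gamma>" "0 \<le> l" using C a \<gamma> l0 by auto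
  qed (use p01 K h hC B \<gamma> in \<open>auto simp: A_def\<close>)
  have A_up: "A (xs @ ys)" if "A xs" for xs ys
    using that depth_sum_nonneg[of h ys] depth_sum_nonneg[of "indicator {1}" ys] h(1)
    by (auto simp: A_def depth_sum_append)
  have "AE \<omega> in M. \<forall>k. A (depth_list (Suc k) \<omega>) \<longrightarrow> (\<lambda>m. (2 ^ m) powr a * \<Psi> (depth_list (2 ^ m) \<omega>)) \<longlonglongrightarrow> 0"
    unfolding AE_all_countable using a \<gamma> by (intro allI AE_decay[OF \<Psi>(1,2) A_up]) auto
  with grow show ?thesis
  proof eventually_elim
    case (elim \<omega>)
    obtain N where N: "\<And>n. N \<le> n \<Longrightarrow> B \<le> depth_sum h (depth_list n \<omega>)"
      using elim(1) unfolding filterlim_at_top eventually_sequentially by blast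
    have A_D: "A (depth_list n \<omega>)" if "N \<le> n" "1 \<le> n" for n
      using N[OF that(1)] root_count_ge_1[OF that(2)] by (simp add: A_def)
    have lim: "(\<lambda>m. (2 ^ m) powr a * \<Psi> (depth_list (2 ^ m) \<omega>)) \<longlonglongrightarrow> 0"
      using elim(2)[rule_format, of N] A_D[of "Suc N"] by simp
    have "(\<lambda>m. (2 ^ m) powr a / depth_sum (indicator {1}) (depth_list (2 ^ m) \<omega>)) \<longlonglongrightarrow> 0"
    proof (rule tendsto_sandwich[OF _ _ tendsto_const lim])
      show "\<forall>\<^sub>F m in sequentially. 0 \<le> (2 ^ m) powr a / depth_sum (indicator {1}) (depth_list (2 ^ m) \<omega>)"
        by (intro always_eventually allI divide_nonneg_nonneg depth_sum_nonneg) auto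
      show "\<forall>\<^sub>F m in sequentially. (2 ^ m) powr a / depth_sum (indicator {1}) (depth_list (2 ^ m) \<omega>)
          \<le> (2 ^ m) powr a * \<Psi> (depth_list (2 ^ m) \<omega>)"
        using eventually_ge_at_top[of N]
      proof eventually_elim
        case (elim m)
        then have "N \<le> 2 ^ m" using less_exp[of m] by linarith
        then have "1 / depth_sum (indicator {1}) (depth_list (2 ^ m) \<omega>) \<le> \<Psi> (depth_list (2 ^ m) \<omega>)"
          by (intro \<Psi>(3) A_D) auto
        from mult_left_mono[OF this, of "(2 ^ m) powr a"] show ?case by simp
      qed
    qed
    moreover have "0 < depth_sum (indicator {1}) (depth_list n \<omega>)" if "1 \<le> n" for n
      using root_count_ge_1[OF that, of \<omega>] by linarith
    ultimately show ?case
      by (intro dyadic_growth depth_sum_depth_list_mono a) auto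
  qed
qed

end

section \<open>Growth of the root degree\<close>

theorem theorem3p9:
  fixes M :: "'w measure" and p :: "nat pmf" and V Z :: "nat \<Rightarrow> 'w \<Rightarrow> nat"
  assumes model: "backward_step_model M p V Z"
    and finite_mean: "integrable (measure_pmf p) real"
    and p0: "0 < pmf p 0" "pmf p 0 < 1"
    and p01: "pmf p 0 + pmf p 1 < 1"
    and aperiodic: "Gcd {j. pmf p j > 0} = 1"
  shows
    "(measure_pmf.expectation p real > 1 \<longrightarrow>
        tendsto_in_prob M (\<lambda>n \<omega>. real (root_degree V Z n \<omega>) / real n) (1 - q_star p)
        \<and> 1 - q_star p > 0)
     \<and>
     (measure_pmf.expectation p real \<le> 1 \<longrightarrow>
        (\<forall>\<delta>>0.
           (AE \<omega> in M. filterlim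
              (\<lambda>n. real (root_degree V Z n \<omega>) / real n powr (1 / R_const p - \<delta>))
              at_top sequentially)
           \<and> (AE \<omega> in M.
              (\<lambda>n. real (root_degree V Z n \<omega>)
                     / (real n powr (1 / R_const p) * ln (real n) powr (1 + \<delta>)))
              \<longlonglongrightarrow> 0)))"
proof (intro conjI impI allI)
  interpret backward_step_model M p V Z by (rule model)
  {
    assume E: "measure_pmf.expectation p real > 1"
    show "tendsto_in_prob M (\<lambda>n \<omega>. real (root_degree V Z n \<omega>) / real n) (1 - q_star p)"
      using root_degree_in_probability[OF p0(1) finite_mean E] .
    show "1 - q_star p > 0" using q_star_fixed_point(2)[OF p0(1) finite_mean E] by simp
  next
    fix \<delta> :: real
    assume E: "measure_pmf.expectation p real \<le> 1" and \<delta>: "0 < \<delta>"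
    obtain s0 where s0: "1 \<le> s0" "pgf_summable p s0" "1 / R_const p = pgf p s0 / s0" "0 < 1 / R_const p"
      and opt: "\<And>s. 0 < s \<Longrightarrow> pgf_summable p s \<Longrightarrow> 1 / R_const p \<le> pgf p s / s"
      using R_const_optimal[OF p0(1) p01 finite_mean E] by blast
    \<comment> \<open>the exponent \<open>1/R - \<delta>\<close> may be negative\<close>
    define a where "a = max 0 (1 / R_const p - \<delta>)"
    have a: "0 \<le> a" "a < 1 / R_const p" using s0(4) \<delta> by (auto simp: a_def)
    have lower: "AE \<omega> in M. filterlim (\<lambda>n. depth_sum (indicator {1}) (depth_list n \<omega>) / real n powr a)
        at_top sequentially"
      by (rule root_count_AE_lower[OF p0(1) p01 _ a]) (rule opt)
    show "AE \<omega> in M. filterlim (\<lambda>n. real (root_degree V Z n \<omega>) / real n powr (1 / R_const p - \<delta>))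
        at_top sequentially"
      using lower root_degree_eq
    proof eventually_elim
      case (elim \<omega>)
      show ?case
      proof (rule filterlim_at_top_mono[OF elim(1)])
        show "\<forall>\<^sub>F n in sequentially. depth_sum (indicator {1}) (depth_list n \<omega>) / real n powr a
            \<le> real (root_degree V Z n \<omega>) / real n powr (1 / R_const p - \<delta>)"
          using eventually_ge_at_top[of 1]
        proof eventually_elim
          case (elim n)
          have "real n powr (1 / R_const p - \<delta>) \<le> real n powr a"
            using elim by (intro powr_mono) (auto simp: a_def)
          then show ?case
            using elim \<open>\<forall>n\<ge>1. real (root_degree V Z n \<omega>) = _ n\<close> by (auto intro!: divide_left_mono)
        qed
      qed
    qed
    show "AE \<omega> in M. (\<lambda>n. real (root_degree V Z n \<omega>)
        / (real n powr (1 / R_const p) * ln (real n) powr (1 + \<delta>))) \<longlonglongrightarrow> 0"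
      using root_count_AE_upper[OF s0(1-3) \<delta>] root_degree_eq
    proof eventually_elim
      case (elim \<omega>)
      show ?case
        by (rule Lim_transform_eventually[OF elim(1)])
           (use elim(2) in \<open>auto intro: eventually_sequentiallyI[of 1]\<close>)
    qed
  }
qed

end
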